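(* Let $\chi=[0,1]$ and let $P_X$ be the uniform distribution on $[0,1]$. Fix any $s\in[0,1]$. Then there exist (1) a class $\widetilde{\mathcal{F}}$ of real-valued functions on $[0,1]$ with $\Phi:=\sup_{f\in\widetilde{\mathcal{F}}}\|f\|_\infty<\infty$, and (2) a function $f_0\in\widetilde{\mathcal{F}}$ such that, for some $A>0$, $\alpha\in[0,2]$ and $\beta\ge0$, $$\sup_Q\ \sup_{\mathcal{F}'\subseteq\widetilde{\mathcal{F}}-f_0}\log N\big(\zeta\|F'\|_{2,Q},\mathcal{F}',\|\cdot\|_{2,Q}\big)\le\frac{A}{\zeta^\alpha}\log^\beta\Big(\frac1\zeta\Big)\quad\text{for all }\zeta\in(0,1)$$ (where $\widetilde{\mathcal{F}}-f_0:=\{f-f_0:f\in\widetilde{\mathcal{F}}\}$, $F'(x):=\sup_{g\in\mathcal{F}'}|g(x)|$, and the supremum in $Q$ is over all finitely supported discrete probability measures on $[0,1]$), and such that the local envelope $F_\delta(x):=\sup\{|f(x)-f_0(x)|:f\in\widetilde{\mathcal{F}},\ \|f-f_0\|\le\delta\}$ satisfies, for some constant $C_0>0$, $\|F_\delta\|\le C_0\Phi^{1-s}\delta^s$ for all $\delta>0$, and (3) an error distribution for $\epsilon$ with $\|\epsilon\|_2<\infty$, such that, for some constant $C>0$ that depends on $s$, the least squares estimator $\widehat f$ over $\widetilde{\mathcal{F}}$ satisfies $$\liminf_{n\to\infty}\ \mathbb{P}\Big(\|\widehat f-f_0\|\ge C\,n^{-1/(2(2-s))}(\log n)^{-2\cdot\mathbf{1}\{s\notin\{0,1\}\}/(s(2-s))}\Big)\ge\frac1{10},$$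 where the exponent of $\log n$ is understood to be $0$ when $s\in\{0,1\}$.
   Context: Setting: $(X_1,Y_1),\dots,(X_n,Y_n)$ are i.i.d. copies of $(X,Y)$ with $X\sim P_X$, $Y=f_0(X)+\epsilon$ and $\mathbb{E}(\epsilon\mid X)=0$. The least squares estimator is $\widehat f:=\arg\min_{f\in\widetilde{\mathcal{F}}}\sum_{i=1}^n(Y_i-f(X_i))^2$ (a minimizer). Norms: for $g:[0,1]\to\mathbb{R}$, $\|g\|^2:=\int g^2\,dP_X$, $\|g\|_\infty:=\sup_x|g(x)|$, and for a measure $Q$, $\|g\|_{2,Q}^2:=\int g^2\,dQ$; $\|\epsilon\|_2:=(\mathbb{E}\epsilon^2)^{1/2}$. Covering number: for a class $\mathcal{G}$ and a (semi)norm $\mathcal{D}$, $N(\zeta,\mathcal{G},\mathcal{D})$ is the smallest $m\ge1$ for which there exist functions $g_1,\dots,g_m$ (not necessarily in $\mathcal{G}$) such that for every $g\in\mathcal{G}$ there is $j\le m$ with $\mathcal{D}(g-g_j)\le\zeta$. *)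

theory Defs
  imports "HOL-Probability.Probability"
begin

text \<open>
  Functions on $[0,1]$ are total functions \<open>real \<Rightarrow> real\<close> of which only the values on \<open>{0..1}\<close> are
  ever used. The uniform distribution on $[0,1]$ is Lebesgue--Borel measure restricted to that
  space; its total mass is already one.
\<close>

definition unif01 :: "real measure" where
  "unif01 = restrict_space lborel {0..1}"

lemma space_unif01 [simp]: "space unif01 = {0..1}"
  by (simp add: unif01_def space_restrict_space)

lemma prob_space_unif01: "prob_space unif01"
  by (rule prob_spaceI) (simp add: unif01_def emeasure_restrict_space space_restrict_space)

definition norm2 :: "'a measure \<Rightarrow> ('a \<Rightarrow> real) \<Rightarrow> real" where
  "norm2 Q g = sqrt (\<integral>x. (g x)\<^sup>2 \<partial>Q)"

definition sup_norm01 :: "(real \<Rightarrow> real) \<Rightarrow> ereal" where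
  "sup_norm01 f = (SUP x\<in>{0..1}. ereal \<bar>f x\<bar>)"

definition class_bound :: "(real \<Rightarrow> real) set \<Rightarrow> ereal" where
  "class_bound F = (SUP f\<in>F. sup_norm01 f)"

definition shifted_class :: "(real \<Rightarrow> real) set \<Rightarrow> (real \<Rightarrow> real) \<Rightarrow> (real \<Rightarrow> real) set" where
  "shifted_class F f0 = (\<lambda>f x. f x - f0 x) ` F"

text \<open>
  The supremum is meaningful for nonempty, pointwise bounded \<open>G\<close>. The empty class occurs below only
  in the radius of a covering of itself, where the covering number is 1 whatever the radius.
\<close>

definition envelope :: "('a \<Rightarrow> real) set \<Rightarrow> 'a \<Rightarrow> real" where
  "envelope G x = (SUP g\<in>G. \<bar>g x\<bar>)"

definition local_envelope :: "(real \<Rightarrow> real) set \<Rightarrow> (real \<Rightarrow> real) \<Rightarrow> real \<Rightarrow> real \<Rightarrow> real" where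
  "local_envelope F f0 \<delta> = envelope {g \<in> shifted_class F f0. norm2 unif01 g \<le> \<delta>}"

text \<open>The covering number is \<open>\<infinity>\<close> (the infimum of the empty set) if there is no finite covering.\<close>

definition covering_number ::
    "real \<Rightarrow> ('a \<Rightarrow> real) set \<Rightarrow> (('a \<Rightarrow> real) \<Rightarrow> real) \<Rightarrow> enat" where
  "covering_number \<zeta> G D =
     Inf {enat m | m. 1 \<le> m \<and>
       (\<exists>c :: nat \<Rightarrow> 'a \<Rightarrow> real. \<forall>g\<in>G. \<exists>j<m. D (\<lambda>x. g x - c j x) \<le> \<zeta>)}"

definition ln_enat :: "enat \<Rightarrow> ereal" where
  "ln_enat N = (case N of enat m \<Rightarrow> ereal (ln (real m)) | \<infinity> \<Rightarrow> \<infinity>)"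

definition uniform_entropy :: "real \<Rightarrow> (real \<Rightarrow> real) set \<Rightarrow> ereal" where
  "uniform_entropy \<zeta> G =
     (SUP Q \<in> {Q :: real pmf. finite (set_pmf Q) \<and> set_pmf Q \<subseteq> {0..1}}. SUP G' \<in> Pow G.
        ln_enat (covering_number (\<zeta> * norm2 (measure_pmf Q) (envelope G')) G'
                                 (norm2 (measure_pmf Q))))"

text \<open>
  \<open>D\<close> is the joint law of $(X, \epsilon)$. The error need not be independent of $X$: only
  $E(\epsilon \mid X) = 0$ is imposed, the conditioning being on the sigma-algebra generated by
  the first coordinate.
\<close>

definition error_law :: "(real \<times> real) measure \<Rightarrow> bool" where
  "error_law D \<longleftrightarrow>
     prob_space D \<and> sets D = sets (unif01 \<Otimes>\<^sub>M borel) \<and> distr D unif01 fst = unif01 \<and>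
     integrable D (\<lambda>z. (snd z)\<^sup>2) \<and>
     (AE z in D. real_cond_exp D (vimage_algebra (space D) fst unif01) snd z = 0)"

definition sample_law ::
    "(real \<Rightarrow> real) \<Rightarrow> (real \<times> real) measure \<Rightarrow> nat \<Rightarrow> (nat \<Rightarrow> real \<times> real) measure" where
  "sample_law f0 D n =
     PiM {..<n} (\<lambda>_. distr D (unif01 \<Otimes>\<^sub>M borel) (\<lambda>(x, e). (x, f0 x + e)))"

definition squared_loss :: "nat \<Rightarrow> (nat \<Rightarrow> real \<times> real) \<Rightarrow> (real \<Rightarrow> real) \<Rightarrow> real" where
  "squared_loss n d f = (\<Sum>i<n. (snd (d i) - f (fst (d i)))\<^sup>2)"

text \<open>
  A least squares estimator maps every sample to some minimizer over \<open>F\<close>. Its estimation error is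
  required to be a random variable, so that probabilities of events about it make sense.
\<close>

definition least_squares_estimator ::
    "(real \<Rightarrow> real) set \<Rightarrow> (real \<Rightarrow> real) \<Rightarrow> (real \<times> real) measure \<Rightarrow>
     (nat \<Rightarrow> (nat \<Rightarrow> real \<times> real) \<Rightarrow> real \<Rightarrow> real) \<Rightarrow> bool" where
  "least_squares_estimator F f0 D fhat \<longleftrightarrow>
     (\<forall>n. (\<forall>d \<in> space (sample_law f0 D n).
              is_arg_min (squared_loss n d) (\<lambda>f. f \<in> F) (fhat n d)) \<and>
          (\<lambda>d. norm2 unif01 (\<lambda>x. fhat n d x - f0 x)) \<in> borel_measurable (sample_law f0 D n))"

end

theory Submission imports Defs begin

text \<open>
  One class and one error law serve all \<open>s\<close>, since the required lower bound never exceeds the order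
  \<open>n powr (- 1 / 4)\<close> and the local envelope at radius \<open>\<delta>\<close> has norm of order \<open>min 1 \<delta>\<close>. Besides the zero
  function the class contains, for each \<open>k\<close>, the indicator of the level \<open>[1 / 4 ^ (k + 1), 1 / 4 ^ k)\<close>
  modulated by \<open>1 \<plusminus> zeta k\<close> with an arbitrary sign on each of \<open>3 * 4 ^ k\<close> cells. The error is a fair sign
  times \<open>4 / zeta k\<close> on level \<open>k\<close>. With \<open>zeta k\<close> of order \<open>k / 2 ^ k\<close> its variance is a convergent sum of
  terms of order \<open>1 / k\<^sup>2\<close>, while the sign patterns, invisible at relative precision
  \<open>\<eta> \<ge> 2 * zeta k\<close>, cost entropy of order \<open>(ln (1 / \<eta>))\<^sup>2 / \<eta>\<^sup>2\<close>.

  If \<open>16 ^ k\<close> is a large multiple of \<open>n\<close>, most cells of level \<open>k\<close> contain at most one design point, so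
  that a sign pattern can follow the signs of the errors and gains \<open>2 * zeta k * (4 / zeta k) = 8\<close> per
  point, more than the quadratic cost of at most 4. Much finer levels contain too few points to gain as
  much, so the estimator lives on a level not much finer than \<open>k\<close>, whose functions have norm of order
  \<open>1 / 2 ^ k\<close>, that is \<open>n powr (- 1 / 4)\<close>.
\<close>

section \<open>The class of modulated bumps\<close>

definition lvl :: "nat \<Rightarrow> real set" where
  "lvl k = {1 / 4 ^ (k + 1) ..< 1 / 4 ^ k}"

text \<open>The factor \<open>k + 1\<close> makes the noise variance carried by level
  \<open>k\<close> summable over the levels; the 4 in the denominator keeps
  \<open>1 + zeta k\<close> and \<open>1 - zeta k\<close> between 1/2 and 3/2.\<close>

definition zeta :: "nat \<Rightarrow> real" where
  "zeta k = real (k + 1) / (4 * 2 ^ k)"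

text \<open>Cells have width \<open>1 / 4 ^ (2 * k + 1)\<close>, and level \<open>k\<close> consists
  exactly of those numbered from \<open>4 ^ k\<close> to \<open>4 ^ (k + 1) - 1\<close>.\<close>

definition cell :: "nat \<Rightarrow> real \<Rightarrow> nat" where
  "cell k x = nat \<lfloor>x * 4 ^ (2 * k + 1)\<rfloor>"

definition bump :: "nat \<Rightarrow> nat set \<Rightarrow> real \<Rightarrow> real" where
  "bump k W x = indicator (lvl k) x * (1 + zeta k * (if cell k x \<in> W then 1 else - 1))"

definition bumps :: "(real \<Rightarrow> real) set" where
  "bumps = insert (\<lambda>_. 0) (\<Union>k. bump k ` Pow {..<4 ^ (k + 1)})"

lemma zeta_pos: "0 < zeta k"
  by (simp add: zeta_def)

lemma zeta_le_half: "zeta k \<le> 1 / 2"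
proof -
  have "k + 1 \<le> 2 * 2 ^ k"
    by (induction k) auto
  then have "real (k + 1) \<le> 2 * 2 ^ k"
    by (metis of_nat_le_iff of_nat_mult of_nat_numeral of_nat_power)
  then show ?thesis
    by (simp add: zeta_def field_simps)
qed

lemma lvl_disjoint:
  assumes "x \<in> lvl j" "x \<in> lvl k" shows "j = k"
proof -
  have False if "x \<in> lvl j" "x \<in> lvl k" "j < k" for j k
  proof -
    have "(4::real) ^ (j + 1) \<le> 4 ^ k"
      using that by (intro power_increasing) auto
    then have "1 / 4 ^ k \<le> (1::real) / 4 ^ (j + 1)"
      by (intro divide_left_mono) auto
    then show False
      using that by (auto simp: lvl_def simp del: power_Suc)
  qed
  then show ?thesis
    using assms by (metis linorder_neqE_nat)
qed

lemma lvl_01: "x \<in> lvl k \<Longrightarrow> x \<in> {0..1}"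
proof -
  assume x: "x \<in> lvl k"
  have "0 \<le> 1 / (4::real) ^ (k + 1)" "1 / (4::real) ^ k \<le> 1"
    by auto
  moreover have "1 / 4 ^ (k + 1) \<le> x" "x < 1 / 4 ^ k"
    using x unfolding lvl_def by auto
  ultimately have "0 \<le> x" "x \<le> 1"
    by linarith+
  then show ?thesis
    by simp
qed

lemma lvl_measurable [measurable]: "lvl k \<in> sets borel"
  by (simp add: lvl_def)

text \<open>The levels shrink towards 0, and 0 lies in none of them; hence a finite sample misses
  all sufficiently fine levels.\<close>

lemma lvl_eventually_notin:
  "\<forall>\<^sub>F k in sequentially. x \<notin> lvl k"
proof (cases "x > 0")
  case True
  obtain K where "(1 / 4 :: real) ^ K < x"
    using True real_arch_pow_inv[of x "1 / 4"] by auto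
  moreover have "(1 / 4 :: real) ^ k \<le> (1 / 4) ^ K" if "k \<ge> K" for k
    using that by (intro power_decreasing) auto
  ultimately show ?thesis
    by (force simp: eventually_sequentially lvl_def power_divide intro!: exI[of _ K])
next
  case False
  have "x \<notin> lvl k" for k
  proof -
    have "0 < 1 / (4::real) ^ (k + 1)"
      by simp
    with False have "\<not> 1 / 4 ^ (k + 1) \<le> x"
      by linarith
    then show ?thesis
      by (simp add: lvl_def)
  qed
  then show ?thesis
    by simp
qed

lemma measurable_cell [measurable]: "cell k \<in> borel \<rightarrow>\<^sub>M count_space UNIV"
  unfolding cell_def by measurable

lemma bump_measurable_borel [measurable]: "bump k W \<in> borel_measurable borel"
  unfolding bump_def by measurable

lemma borel_measurable_unif01I: "f \<in> borel_measurable borel \<Longrightarrow> f \<in> borel_measurable unif01"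
  unfolding unif01_def by (intro measurable_restrict_space1) auto

lemma bumps_measurable_borel: "f \<in> bumps \<Longrightarrow> f \<in> borel_measurable borel"
  by (auto simp: bumps_def)

text \<open>Each level has finitely many patterns. Countability makes envelopes measurable and lets
  a minimizer be chosen measurably along an enumeration.\<close>

lemma countable_bumps: "countable bumps"
  unfolding bumps_def
  by (intro countable_insert countable_UN countableI_type countable_image countable_finite) auto

lemma bump_nonneg: "0 \<le> bump k W x"
  using zeta_le_half[of k] zeta_pos[of k] by (auto simp: bump_def indicator_def)

lemma bump_le: "bump k W x \<le> 2 * indicator (lvl k) x"
  using zeta_le_half[of k] zeta_pos[of k] by (auto simp: bump_def indicator_def)

lemma bump_ge: "indicator (lvl k) x / 2 \<le> bump k W x"
  using zeta_le_half[of k] zeta_pos[of k] by (auto simp: bump_def indicator_def)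

text \<open>All sign patterns of a level lie in one ball of relative radius \<open>zeta k\<close>
  around the plain indicator, so at coarser precision a single centre serves them all.\<close>

lemma bump_dist: "\<bar>bump k W x - indicator (lvl k) x\<bar> = zeta k * indicator (lvl k) x"
  using zeta_pos[of k] by (auto simp: bump_def indicator_def)

lemma bumps_cases:
  assumes "g \<in> bumps"
  obtains "g = (\<lambda>_. 0)" | k W where "W \<subseteq> {..<4 ^ (k + 1)}" "g = bump k W"
  using assms unfolding bumps_def by blast

lemma bumps_range: "g \<in> bumps \<Longrightarrow> 0 \<le> g x \<and> g x \<le> 2"
  by (erule bumps_cases)
     (auto simp: bump_nonneg intro!: order_trans[OF bump_le] split: split_indicator)

lemma zero_in_bumps: "(\<lambda>_. 0) \<in> bumps"
  by (simp add: bumps_def)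

lemma bump_in_bumps: "W \<subseteq> {..<4 ^ (k + 1)} \<Longrightarrow> bump k W \<in> bumps"
  by (auto simp: bumps_def)

lemma shifted_class_zero: "shifted_class F (\<lambda>_. 0) = F"
  by (simp add: shifted_class_def)

section \<open>Norms and envelopes under the uniform law\<close>

lemma emeasure_unif01: "A \<in> sets borel \<Longrightarrow> A \<subseteq> {0..1} \<Longrightarrow> emeasure unif01 A = emeasure lborel A"
  by (simp add: unif01_def emeasure_restrict_space)

lemma sets_unif01_borel: "A \<in> sets borel \<Longrightarrow> A \<subseteq> {0..1} \<Longrightarrow> A \<in> sets unif01"
  by (auto simp: unif01_def sets_restrict_space)

lemma measure_lvl: "measure unif01 (lvl k) = 3 / 4 ^ (k + 1)"
proof -
  have "lvl k \<subseteq> {0..1}"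
    using lvl_01 by blast
  then have "measure unif01 (lvl k) = measure lborel (lvl k)"
    by (simp add: measure_def emeasure_unif01)
  also have "\<dots> = 1 / 4 ^ k - 1 / 4 ^ (k + 1)"
    unfolding lvl_def by (subst measure_lborel_Ico) (auto intro!: divide_left_mono)
  finally show ?thesis
    by (simp add: field_simps)
qed

lemma norm2_mono:
  assumes "integrable Q (\<lambda>x. (h x)\<^sup>2)" "\<And>x. x \<in> space Q \<Longrightarrow> \<bar>g x\<bar> \<le> \<bar>h x\<bar>"
  shows "norm2 Q g \<le> norm2 Q h"
  unfolding norm2_def using assms
  by (intro real_sqrt_le_mono integral_mono') (auto simp: abs_le_square_iff)

text \<open>A bump is at least 1/2 on a set of measure \<open>3 / 4 ^ (k + 1)\<close>. This confines
  small balls around 0 to fine levels, and later turns a bound on the level of the estimator into a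
  lower bound on its error.\<close>

lemma norm2_bump_ge: "sqrt 3 / (4 * 2 ^ k) \<le> norm2 unif01 (bump k W)"
proof -
  interpret prob_space unif01 by (rule prob_space_unif01)
  have [measurable]: "lvl k \<in> sets unif01"
    using lvl_01 by (intro sets_unif01_borel) auto
  have [measurable]: "bump k W \<in> borel_measurable unif01"
    by (intro borel_measurable_unif01I) measurable
  have "sqrt 3 / (4 * 2 ^ k) = sqrt (3 / (16 * (2 ^ k)\<^sup>2))"
    by (simp add: real_sqrt_divide real_sqrt_mult)
  also have "3 / (16 * (2 ^ k)\<^sup>2) = measure unif01 (lvl k) * (1 / 4 :: real)"
    by (simp add: measure_lvl power2_eq_square flip: power_mult_distrib)
  also have "measure unif01 (lvl k) * (1 / 4) = (\<integral>x. (indicator (lvl k) x / 2 :: real)\<^sup>2 \<partial>unif01)"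
  proof -
    have "(\<integral>x. (indicator (lvl k) x / 2 :: real)\<^sup>2 \<partial>unif01)
        = (\<integral>x. indicator (lvl k) x * (1 / 4) \<partial>unif01)"
      by (intro Bochner_Integration.integral_cong) (auto simp: indicator_def power2_eq_square)
    moreover have "lvl k \<inter> {0..1} = lvl k"
      using lvl_01 by blast
    ultimately show ?thesis
      by simp
  qed
  also have "sqrt \<dots> \<le> norm2 unif01 (bump k W)"
    unfolding norm2_def[symmetric]
  proof (rule norm2_mono)
    show "integrable unif01 (\<lambda>x. (bump k W x)\<^sup>2)"
      by (rule integrable_const_bound[of _ 4])
         (use bump_nonneg[of k W] order_trans[OF bump_le[of k W], of _ 2] in
           \<open>auto intro!: power2_le_iff_abs_le[THEN iffD2, of 2, simplified] simp: indicator_def\<close>)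
    show "\<bar>indicator (lvl k) x / 2\<bar> \<le> \<bar>bump k W x\<bar>" for x
      using bump_ge[of k x W] bump_nonneg[of k W x] by (auto simp: indicator_def)
  qed
  finally show ?thesis .
qed

lemma class_bound_bumps: "class_bound bumps < \<infinity>" "0 < real_of_ereal (class_bound bumps)"
proof -
  have le: "class_bound bumps \<le> ereal 2"
    unfolding class_bound_def sup_norm01_def
    using bumps_range by (intro SUP_least) (simp add: abs_of_nonneg)
  then show "class_bound bumps < \<infinity>"
    by (cases "class_bound bumps") auto
  \<comment> \<open>The point 1/4 is the left endpoint of level 0, where a bump of that level is at
    least 1/2. Positivity allows division by a power of the class bound later.\<close>
  have "ereal (1 / 2) \<le> ereal \<bar>bump 0 {} (1 / 4)\<bar>"
    using bump_ge[of 0 "1 / 4" "{}"] bump_nonneg[of 0 "{}" "1 / 4"] by (simp add: lvl_def)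
  also have "\<dots> \<le> sup_norm01 (bump 0 {})"
    unfolding sup_norm01_def by (intro SUP_upper) auto
  also have "\<dots> \<le> class_bound bumps"
    unfolding class_bound_def by (intro SUP_upper bump_in_bumps) auto
  finally show "0 < real_of_ereal (class_bound bumps)"
    using le by (cases "class_bound bumps") auto
qed

lemma envelope_upper:
  assumes "G \<subseteq> bumps" "g \<in> G" shows "0 \<le> g x" "g x \<le> envelope G x"
proof -
  show "0 \<le> g x"
    using assms bumps_range by blast
  have "\<bar>g x\<bar> \<le> envelope G x"
    unfolding envelope_def
  proof (rule cSUP_upper[OF assms(2)])
    show "bdd_above ((\<lambda>g. \<bar>g x\<bar>) ` G)"
      using assms(1) bumps_range by (intro bdd_aboveI2[of _ _ 2]) (metis abs_of_nonneg subsetD)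
  qed
  then show "g x \<le> envelope G x"
    by simp
qed

lemma envelope_measurable:
  assumes "G \<subseteq> bumps" shows "envelope G \<in> borel_measurable borel"
proof -
  have "(\<lambda>x. SUP g\<in>G. \<bar>g x\<bar>) \<in> borel_measurable borel"
  proof (rule borel_measurable_cSUP)
    show "countable G"
      using assms countable_bumps countable_subset by blast
    show "(\<lambda>x. \<bar>g x\<bar>) \<in> borel_measurable borel" if "g \<in> G" for g
      using that assms bumps_measurable_borel by (intro borel_measurable_abs) blast
    show "bdd_above ((\<lambda>g. \<bar>g x\<bar>) ` G)" for x :: real
      using assms bumps_range by (intro bdd_aboveI2[of _ _ 2]) (metis abs_of_nonneg subsetD)
  qed
  then show ?thesis
    by (simp add: envelope_def[abs_def])
qed

text \<open>By \<open>norm2_bump_ge\<close> a bump of norm at most \<delta> lives on a level with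
  \<open>1 / 4 ^ k\<close> at most 16/3 times the square of \<delta>; the constant 6 rounds this up.
  All these levels lie in one short interval at 0.\<close>

lemma local_envelope_bumps_le:
  assumes "0 < \<delta>"
  shows "0 \<le> local_envelope bumps (\<lambda>_. 0) \<delta> x"
    "local_envelope bumps (\<lambda>_. 0) \<delta> x \<le> 2 * indicator {0..6 * \<delta>\<^sup>2} x"
proof -
  let ?G = "{g \<in> bumps. norm2 unif01 g \<le> \<delta>}"
  have zero: "(\<lambda>_. 0) \<in> ?G"
    using assms by (simp add: zero_in_bumps norm2_def)
  show "0 \<le> local_envelope bumps (\<lambda>_. 0) \<delta> x"
    unfolding local_envelope_def shifted_class_zero
    using envelope_upper(2)[OF _ zero, of x] by auto
  show "local_envelope bumps (\<lambda>_. 0) \<delta> x \<le> 2 * indicator {0..6 * \<delta>\<^sup>2} x"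
    unfolding local_envelope_def shifted_class_zero envelope_def
  proof (rule cSUP_least)
    show "?G \<noteq> {}"
      using zero by blast
    fix g assume g: "g \<in> ?G"
    then have "g \<in> bumps" by simp
    then show "\<bar>g x\<bar> \<le> 2 * indicator {0..6 * \<delta>\<^sup>2} x"
    proof (cases rule: bumps_cases)
      case 1
      then show ?thesis by simp
    next
      case (2 k W)
      have "sqrt 3 / (4 * 2 ^ k) \<le> \<delta>"
        using norm2_bump_ge[of k W] g 2 by auto
      then have "(sqrt 3 / (4 * 2 ^ k))\<^sup>2 \<le> \<delta>\<^sup>2"
        by (intro power_mono) auto
      then have "3 / (16 * 4 ^ k) \<le> \<delta>\<^sup>2"
        by (simp add: power_divide power_mult_distrib power2_eq_square flip: power_mult_distrib)
      then have "1 / 4 ^ k \<le> 6 * \<delta>\<^sup>2"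
        by (simp add: field_simps)
      then have "x \<in> {0..6 * \<delta>\<^sup>2}" if "x \<in> lvl k"
        using that lvl_01[OF that] by (auto simp: lvl_def)
      then have "indicator (lvl k) x \<le> (indicator {0..6 * \<delta>\<^sup>2} x :: real)"
        by (auto simp: indicator_def)
      then show ?thesis
        using bump_le[of k W x] bump_nonneg[of k W x] 2 by auto
    qed
  qed
qed

lemma local_envelope_bumps_measurable:
  "local_envelope bumps (\<lambda>_. 0) \<delta> \<in> borel_measurable unif01"
  unfolding local_envelope_def shifted_class_zero
  by (intro borel_measurable_unif01I envelope_measurable) auto

text \<open>The norm is at most \<open>2 * min 1 (3 * \<delta>)\<close>, and
  \<open>min 1 (3 * \<delta>)\<close> is below \<open>(3 * \<delta>) powr s\<close> for every
  \<open>s\<close> in the unit interval, which is why one class serves all \<open>s\<close>. The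
  constant is 2 times 3, the latter bounding \<open>3 powr s\<close>.\<close>

lemma norm2_local_envelope_bumps:
  assumes "0 < \<delta>" "0 \<le> s" "s \<le> 1"
  shows "norm2 unif01 (local_envelope bumps (\<lambda>_. 0) \<delta>) \<le> 6 * \<delta> powr s"
proof -
  interpret prob_space unif01 by (rule prob_space_unif01)
  let ?I = "{0..min 1 (6 * \<delta>\<^sup>2)}"
  have I [measurable]: "?I \<in> sets unif01"
    by (intro sets_unif01_borel) auto
  have "norm2 unif01 (local_envelope bumps (\<lambda>_. 0) \<delta>) \<le> norm2 unif01 (\<lambda>x. 2 * indicator ?I x)"
  proof (rule norm2_mono)
    show "integrable unif01 (\<lambda>x. (2 * indicator ?I x :: real)\<^sup>2)"
    proof (rule integrable_const_bound[of _ 4])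
      show "(\<lambda>x. (2 * indicator ?I x :: real)\<^sup>2) \<in> borel_measurable unif01"
        by measurable
    qed (auto simp: indicator_def)
    show "\<bar>local_envelope bumps (\<lambda>_. 0) \<delta> x\<bar> \<le> \<bar>2 * indicator ?I x\<bar>" if "x \<in> space unif01" for x
      using local_envelope_bumps_le[OF assms(1), of x] that by (auto simp: indicator_def split: if_splits)
  qed
  also have "\<dots> = sqrt (\<integral>x. 4 * indicator ?I x \<partial>unif01)"
    unfolding norm2_def
    by (intro arg_cong[of _ _ sqrt] Bochner_Integration.integral_cong) (auto simp: indicator_def)
  also have "\<dots> = sqrt (4 * measure unif01 ?I)"
  proof -
    have "?I \<inter> {0..1} = ?I"
      by auto
    then show ?thesis
      by simp
  qed
  also have "measure unif01 ?I = min 1 (6 * \<delta>\<^sup>2)"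
  proof -
    have "measure unif01 ?I = measure lborel ?I"
      unfolding measure_def by (subst emeasure_unif01) auto
    then show ?thesis
      using assms by simp
  qed
  also have "sqrt (4 * min 1 (6 * \<delta>\<^sup>2)) \<le> sqrt ((2 * (min 1 (3 * \<delta>)))\<^sup>2)"
  proof (rule real_sqrt_le_mono)
    have "6 * \<delta>\<^sup>2 \<le> (3 * \<delta>)\<^sup>2"
      by (simp add: power_mult_distrib)
    then show "4 * min 1 (6 * \<delta>\<^sup>2) \<le> (2 * min 1 (3 * \<delta>))\<^sup>2"
      by (auto simp: min_def power_mult_distrib)
  qed
  also have "\<dots> = 2 * min 1 (3 * \<delta>)"
    using assms by (simp only: real_sqrt_abs)
  also have "min 1 (3 * \<delta>) \<le> (3 * \<delta>) powr s"
  proof (cases "3 * \<delta> \<le> 1")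
    case True
    then have "(3 * \<delta>) powr 1 \<le> (3 * \<delta>) powr s"
      using assms by (intro powr_mono') auto
    then show ?thesis
      using assms True by simp
  next
    case False
    then show ?thesis
      using assms by (auto intro: ge_one_powr_ge_zero)
  qed
  also have "(3 * \<delta>) powr s \<le> 3 * \<delta> powr s"
    using assms powr_mono[of s 1 "3::real"] by (simp add: powr_mult mult_right_mono)
  finally show ?thesis
    by simp
qed

section \<open>Uniform entropy\<close>

lemma ln_covering_number_le:
  assumes "finite C" "C \<noteq> {}" "\<And>g. g \<in> G \<Longrightarrow> \<exists>c\<in>C. D (\<lambda>x. g x - c x) \<le> \<zeta>"
  shows "ln_enat (covering_number \<zeta> G D) \<le> ereal (ln (card C))"
proof -
  obtain c where "bij_betw c {0..<card C} C"
    using ex_bij_betw_nat_finite[OF assms(1)] by blast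
  then have c: "C = c ` {..<card C}"
    by (simp add: bij_betw_def lessThan_atLeast0)
  have "\<exists>j<card C. D (\<lambda>x. g x - c j x) \<le> \<zeta>" if "g \<in> G" for g
  proof -
    obtain h where h: "h \<in> C" "D (\<lambda>x. g x - h x) \<le> \<zeta>"
      using assms(3) \<open>g \<in> G\<close> by metis
    then obtain j where "j < card C" "h = c j"
      using c by blast
    with h show ?thesis
      by blast
  qed
  moreover have pos: "1 \<le> card C"
    using assms(1,2) by (simp add: Suc_leI card_gt_0_iff)
  ultimately have "covering_number \<zeta> G D \<le> enat (card C)"
    unfolding covering_number_def by (intro Inf_lower) blast
  then obtain m where m: "covering_number \<zeta> G D = enat m" "m \<le> card C"
    by (cases "covering_number \<zeta> G D") auto
  \<comment> \<open>The case \<open>m = 0\<close> is settled by the convention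
    \<open>ln 0 = 0\<close>, the right-hand side being nonnegative.\<close>
  then have "ln (real m) \<le> ln (real (card C))"
    using pos by (cases "m = 0") auto
  then show ?thesis
    by (simp add: m ln_enat_def)
qed

lemma norm2_pmf_mono:
  fixes Q :: "'a pmf"
  assumes "finite (set_pmf Q)" "\<And>x. \<bar>g x\<bar> \<le> \<bar>h x\<bar>"
  shows "norm2 (measure_pmf Q) g \<le> norm2 (measure_pmf Q) h"
  using assms by (intro norm2_mono integrable_measure_pmf_finite) auto

lemma norm2_scale: "0 \<le> a \<Longrightarrow> norm2 M (\<lambda>x. a * g x) = a * norm2 M g"
  by (simp add: norm2_def power_mult_distrib real_sqrt_mult)

lemma norm2_indicator_pmf:
  "norm2 (measure_pmf Q) (indicator A) = sqrt (measure_pmf.prob Q A)"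
proof -
  have "(\<lambda>x. (indicator A x)\<^sup>2) = (indicator A :: 'a \<Rightarrow> real)"
    by (auto simp: indicator_def)
  then show ?thesis
    by (simp add: norm2_def)
qed

text \<open>Members of \<open>G\<close> take values between 0 and the envelope, so the single centre
  \<open>envelope G / 2\<close> is within half the envelope of each. An exact zero is required here
  because the entropy bound tends to 0 as the precision tends to 1.\<close>

lemma ln_covering_coarse:
  assumes Q: "finite (set_pmf Q)" and G: "G \<subseteq> bumps" and \<eta>: "1 / 2 \<le> \<eta>"
  shows "ln_enat (covering_number (\<eta> * norm2 (measure_pmf Q) (envelope G)) G (norm2 (measure_pmf Q))) \<le> 0"
proof -
  let ?E = "envelope G" and ?n = "norm2 (measure_pmf Q)"
  have "ln_enat (covering_number (\<eta> * ?n ?E) G ?n) \<le> ereal (ln (card {\<lambda>x. ?E x / 2}))"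
  proof (rule ln_covering_number_le)
    fix g assume g: "g \<in> G"
    have "\<bar>g x - ?E x / 2\<bar> \<le> \<bar>1 / 2 * ?E x\<bar>" for x
      using envelope_upper[OF G g, of x] by linarith
    then have "?n (\<lambda>x. g x - ?E x / 2) \<le> ?n (\<lambda>x. 1 / 2 * ?E x)"
      by (rule norm2_pmf_mono[OF Q])
    also have "\<dots> = 1 / 2 * ?n ?E"
      by (rule norm2_scale) simp
    also have "\<dots> \<le> \<eta> * ?n ?E"
      using \<eta> by (intro mult_right_mono) (auto simp: norm2_def)
    finally show "\<exists>c\<in>{\<lambda>x. ?E x / 2}. ?n (\<lambda>x. g x - c x) \<le> \<eta> * ?n ?E"
      by simp
  qed auto
  then show ?thesis
    by (simp add: zero_ereal_def)
qed

text \<open>At most one level contains \<open>x\<close>, and there the envelope is at least 1/2.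
  Integrated against \<open>Q\<close>, this bounds the total mass of the levels met by
  \<open>G\<close>.\<close>

lemma sum_lvl_indicator_le:
  assumes "finite B" "\<And>k. k \<in> B \<Longrightarrow> \<exists>W. bump k W \<in> G" "G \<subseteq> bumps"
  shows "(\<Sum>k\<in>B. indicator (lvl k) x) \<le> 4 * (envelope G x)\<^sup>2"
proof (cases "\<exists>k\<in>B. x \<in> lvl k")
  case True
  then obtain k where k: "k \<in> B" "x \<in> lvl k" by blast
  then obtain W where W: "bump k W \<in> G"
    using assms(2) by blast
  have "(\<Sum>j\<in>B. indicator (lvl j) x) = (\<Sum>j\<in>B. if j = k then 1 else 0 :: real)"
    using k lvl_disjoint by (intro sum.cong) (auto simp: indicator_def)
  also have "\<dots> = 1"
    using k assms(1) by simp
  also have "\<dots> \<le> 4 * (1 / 2)\<^sup>2"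
    by (simp add: power2_eq_square)
  also have "\<dots> \<le> 4 * (envelope G x)\<^sup>2"
    using bump_ge[of k x W] k envelope_upper(2)[OF assms(3) W, of x]
    by (intro mult_left_mono power_mono) auto
  finally show ?thesis .
next
  case False
  then have "(\<Sum>k\<in>B. indicator (lvl k) x) = (0::real)"
    by (intro sum.neutral) auto
  then show ?thesis by simp
qed

text \<open>Disjointness of the levels bounds the number of those that are heavy under \<open>Q\<close>; the bumps on
  the remaining levels are covered by the zero function.\<close>

lemma heavy_levels:
  assumes Q: "finite (set_pmf Q)" and G: "G \<subseteq> bumps" and \<eta>: "0 < \<eta>"
  defines "r \<equiv> norm2 (measure_pmf Q) (envelope G)"
  defines "H \<equiv> {k. (\<exists>W. bump k W \<in> G) \<and> (\<eta> * r)\<^sup>2 < 4 * measure_pmf.prob Q (lvl k)}"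
  shows "finite H" "real (card H) \<le> 16 / \<eta>\<^sup>2"
proof -
  have r0: "0 \<le> r"
    by (simp add: r_def norm2_def)
  have r2: "r\<^sup>2 = measure_pmf.expectation Q (\<lambda>x. (envelope G x)\<^sup>2)"
    by (simp add: r_def norm2_def)
  have sum_le: "(\<Sum>k\<in>B. measure_pmf.prob Q (lvl k)) \<le> 4 * r\<^sup>2"
    if B: "finite B" "B \<subseteq> H" for B
  proof -
    have "(\<Sum>k\<in>B. measure_pmf.prob Q (lvl k))
        = measure_pmf.expectation Q (\<lambda>x. \<Sum>k\<in>B. indicator (lvl k) x)"
      by (subst Bochner_Integration.integral_sum) (auto intro: integrable_measure_pmf_finite Q)
    also have "\<dots> \<le> measure_pmf.expectation Q (\<lambda>x. 4 * (envelope G x)\<^sup>2)"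
      using sum_lvl_indicator_le[of B G] B G
      by (intro integral_mono integrable_measure_pmf_finite Q) (auto simp: H_def)
    finally show ?thesis
      by (simp add: r2)
  qed
  have card_le: "real (card B) \<le> 16 / \<eta>\<^sup>2" if B: "finite B" "B \<subseteq> H" for B
  proof (cases "B = {}")
    case True
    then show ?thesis by simp
  next
    case False
    have "real (card B) * (\<eta> * r)\<^sup>2 = (\<Sum>k\<in>B. (\<eta> * r)\<^sup>2)"
      by simp
    also have less: "\<dots> < (\<Sum>k\<in>B. 4 * measure_pmf.prob Q (lvl k))"
      using B False by (intro sum_strict_mono) (auto simp: H_def)
    also have le: "\<dots> \<le> 16 * r\<^sup>2"
      using sum_le[OF B] by (simp flip: sum_distrib_left)
    finally have *: "real (card B) * \<eta>\<^sup>2 * r\<^sup>2 < 16 * r\<^sup>2"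
      by (simp add: power_mult_distrib mult.assoc)
    \<comment> \<open>With \<open>r = 0\<close> both sides of the strict inequality would
      vanish.\<close>
    then have "r\<^sup>2 > 0"
      by (cases "r = 0") auto
    with * have "real (card B) * \<eta>\<^sup>2 < 16"
      by (simp add: mult_less_cancel_right)
    then show ?thesis
      using \<eta> by (simp add: field_simps)
  qed
  show "finite H"
  proof (rule finite_if_finite_subsets_card_bdd[THEN conjunct1])
    show "card B \<le> nat \<lfloor>16 / \<eta>\<^sup>2\<rfloor>" if "B \<subseteq> H" "finite B" for B
      using card_le[OF that(2,1)] by (simp add: le_nat_floor)
  qed
  then show "real (card H) \<le> 16 / \<eta>\<^sup>2"
    by (rule card_le) simp
qed

text \<open>The cover lists all bumps on levels below \<open>K\<close>, represents each heavy level
  by its indicator, and leaves the other bumps to the zero function. The bumps on levels below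
  \<open>K\<close> number at most \<open>2 ^ (4 ^ K + 1)\<close>, whose logarithm is the term
  \<open>4 ^ K + 1\<close>.\<close>

lemma ln_covering_fine:
  assumes Q: "finite (set_pmf Q)" and G: "G \<subseteq> bumps" and \<eta>: "0 < \<eta>" "\<eta> \<le> 1"
    and K: "\<And>k. K \<le> k \<Longrightarrow> zeta k \<le> \<eta> / 2"
  shows "ln_enat (covering_number (\<eta> * norm2 (measure_pmf Q) (envelope G)) G (norm2 (measure_pmf Q)))
    \<le> ereal (ln (17 / \<eta>\<^sup>2) + (4 ^ K + 1))"
proof -
  let ?E = "envelope G" and ?n = "norm2 (measure_pmf Q)"
  define H where "H = {k. (\<exists>W. bump k W \<in> G) \<and> (\<eta> * ?n ?E)\<^sup>2 < 4 * measure_pmf.prob Q (lvl k)}"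
  define B where "B = (\<Union>k<K. bump k ` Pow {..<4 ^ (k + 1)})"
  define C where "C = insert (\<lambda>_. 0) ((\<lambda>k. indicator (lvl k)) ` H \<union> B)"
  have H: "finite H" "real (card H) \<le> 16 / \<eta>\<^sup>2"
    using heavy_levels[OF Q G \<eta>(1)] by (auto simp: H_def)
  have finB: "finite B"
    by (auto simp: B_def)
  have n0: "0 \<le> ?n g" for g
    by (simp add: norm2_def)
  have "ln_enat (covering_number (\<eta> * ?n ?E) G ?n) \<le> ereal (ln (card C))"
  proof (rule ln_covering_number_le)
    show "finite C" "C \<noteq> {}"
      using H finB by (auto simp: C_def)
    fix g assume g: "g \<in> G"
    then have "g \<in> bumps"
      using G by blast
    then show "\<exists>c\<in>C. ?n (\<lambda>x. g x - c x) \<le> \<eta> * ?n ?E"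
    proof (cases rule: bumps_cases)
      case 1
      then show ?thesis
        using n0[of ?E] \<eta> by (intro bexI[of _ "\<lambda>_. 0"]) (auto simp: C_def norm2_def)
    next
      case (2 k W)
      \<comment> \<open>The bump belongs to \<open>G\<close> and is at least 1/2 on its level, so
        the envelope of \<open>G\<close> controls the indicator up to a factor 2.\<close>
      have lvlE: "?n (indicator (lvl k)) \<le> 2 * ?n ?E"
      proof -
        have "?n (indicator (lvl k)) \<le> ?n (\<lambda>x. 2 * ?E x)"
        proof (rule norm2_pmf_mono[OF Q])
          show "\<bar>indicator (lvl k) x\<bar> \<le> \<bar>2 * ?E x\<bar>" for x
            using bump_ge[of k x W] envelope_upper[OF G g, of x] 2 by auto
        qed
        then show ?thesis
          by (simp add: norm2_scale)
      qed
      consider "k < K" | "K \<le> k" "k \<in> H" | "k \<notin> H"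
        by linarith
      then show ?thesis
      proof cases
        case 1
        then have "g \<in> C"
          using 2 by (auto simp: C_def B_def)
        then show ?thesis
          using n0[of ?E] \<eta> by (intro bexI[of _ g]) (auto simp: norm2_def)
      next
        case heavy: 2
        have "?n (\<lambda>x. g x - indicator (lvl k) x) \<le> ?n (\<lambda>x. zeta k * indicator (lvl k) x)"
          using bump_dist[of k W] zeta_pos[of k] 2 by (intro norm2_pmf_mono[OF Q]) auto
        also have "\<dots> = zeta k * ?n (indicator (lvl k))"
          using zeta_pos[of k] by (intro norm2_scale) auto
        \<comment> \<open>The bound \<open>zeta k \<le> \<eta> / 2\<close> beyond level
          \<open>K\<close> absorbs the factor 2 lost in \<open>lvlE\<close>.\<close>
        also have "\<dots> \<le> \<eta> / 2 * (2 * ?n ?E)"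
          using zeta_pos[of k] lvlE heavy K \<eta> n0 by (intro mult_mono) auto
        finally show ?thesis
          using heavy by (intro bexI[of _ "indicator (lvl k)"]) (auto simp: C_def)
      next
        case 3
        have "\<exists>W. bump k W \<in> G"
          using g 2 by blast
        then have *: "4 * measure_pmf.prob Q (lvl k) \<le> (\<eta> * ?n ?E)\<^sup>2"
          using 3 by (auto simp: H_def)
        \<comment> \<open>The factor 4 in the definition of \<open>H\<close> matches this factor 2
          after squaring.\<close>
        have "?n g \<le> ?n (\<lambda>x. 2 * indicator (lvl k) x)"
          using bump_le[of k W] bump_nonneg[of k W] 2 by (intro norm2_pmf_mono[OF Q]) auto
        also have "\<dots> = sqrt (4 * measure_pmf.prob Q (lvl k))"
          by (simp add: norm2_scale norm2_indicator_pmf real_sqrt_mult)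
        also have "\<dots> \<le> \<eta> * ?n ?E"
          using * \<eta> n0[of ?E] by (intro real_le_lsqrt) auto
        finally show ?thesis
          by (intro bexI[of _ "\<lambda>_. 0"]) (auto simp: C_def)
      qed
    qed
  qed
  also have "ln (card C) \<le> ln (17 / \<eta>\<^sup>2) + (4 ^ K + 1)"
  proof -
    have "card B \<le> (\<Sum>k<K. card (bump k ` Pow {..<4 ^ (k + 1)}))"
      unfolding B_def by (rule card_UN_le) simp
    also have "\<dots> \<le> (\<Sum>k<K. 2 ^ 4 ^ (k + 1))"
    proof (rule sum_mono)
      show "card (bump k ` Pow {..<4 ^ (k + 1)}) \<le> 2 ^ 4 ^ (k + 1)" for k
        using card_image_le[of "Pow {..<4 ^ (k + 1)}" "bump k"] by (simp add: card_Pow)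
    qed
    \<comment> \<open>The last summand dominates: the bound for \<open>K\<close> does not exceed the
      next summand, so adding it at most doubles that summand.\<close>
    also have "\<dots> \<le> 2 ^ (4 ^ K + 1)"
    proof (induction K)
      case (Suc K)
      have "(2::nat) ^ (4 ^ K + 1) \<le> 2 ^ 4 ^ (K + 1)"
        by (intro power_increasing) auto
      then show ?case
        using Suc by simp
    qed simp
    finally have B: "card B \<le> 2 ^ (4 ^ K + 1)" .
    have "card C \<le> Suc (card ((\<lambda>k. indicator (lvl k) :: real \<Rightarrow> real) ` H) + card B)"
      unfolding C_def
      by (rule order_trans[OF card_insert_le_m1 Suc_le_mono[THEN iffD2]]) (auto intro: card_Un_le)
    also have "\<dots> \<le> Suc (card H + 2 ^ (4 ^ K + 1))"
      using B card_image_le[OF H(1)] by (intro Suc_le_mono[THEN iffD2] add_mono) auto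
    finally have "real (card C) \<le> real (Suc (card H + 2 ^ (4 ^ K + 1)))"
      by (rule of_nat_mono)
    then have "real (card C) \<le> 1 + 16 / \<eta>\<^sup>2 + 2 ^ (4 ^ K + 1)"
      using H(2) by simp
    also have "1 + 16 / \<eta>\<^sup>2 \<le> 17 / \<eta>\<^sup>2"
    proof -
      have "1 \<le> 1 / \<eta>\<^sup>2"
        using \<eta> by (simp add: power_le_one)
      moreover have "17 / \<eta>\<^sup>2 = 1 / \<eta>\<^sup>2 + 16 / \<eta>\<^sup>2"
        by (simp flip: add_divide_distrib)
      ultimately show ?thesis
        by simp
    qed
    \<comment> \<open>Passing from the sum to the product lets the logarithm split.\<close>
    also have "17 / \<eta>\<^sup>2 + 2 ^ (4 ^ K + 1) \<le> 17 / \<eta>\<^sup>2 * 2 ^ (4 ^ K + 1)"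
    proof -
      have "a + b \<le> a * b" if "2 \<le> a" "2 \<le> b" for a b :: real
        using mult_mono[of 1 "a - 1" 1 "b - 1"] that by (simp add: algebra_simps)
      moreover have "2 \<le> 17 / \<eta>\<^sup>2"
        using \<eta> power_le_one[of \<eta> 2] by (simp add: field_simps)
      moreover have "(2::real) \<le> 2 ^ (4 ^ K + 1)"
        by simp
      ultimately show ?thesis
        by blast
    qed
    finally have "real (card C) \<le> 17 / \<eta>\<^sup>2 * 2 ^ (4 ^ K + 1)"
      by simp
    moreover have "0 < card C"
      using H finB by (auto simp: C_def card_gt_0_iff)
    ultimately have "ln (real (card C)) \<le> ln (17 / \<eta>\<^sup>2 * 2 ^ (4 ^ K + 1))"
      by simp
    also have "\<dots> = ln (17 / \<eta>\<^sup>2) + (4 ^ K + 1) * ln 2"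
      using \<eta> by (subst ln_mult) (auto simp: ln_realpow algebra_simps ln_mult)
    also have "\<dots> \<le> ln (17 / \<eta>\<^sup>2) + (4 ^ K + 1) * 1"
      using ln_2_less_1 by (intro add_left_mono mult_left_mono) auto
    finally show ?thesis
      by simp
  qed
  finally show ?thesis
    by simp
qed

section \<open>The level at which the modulation falls below the precision\<close>

lemma zeta_antimono: "j \<le> k \<Longrightarrow> zeta k \<le> zeta j"
proof (rule lift_Suc_antimono_le[of zeta])
  show "zeta (Suc n) \<le> zeta n" for n
    by (simp add: zeta_def field_simps)
qed

text \<open>Take the least \<open>K\<close> with \<open>zeta K \<le> \<eta> / 2\<close>. Minimality
  gives \<open>2 ^ K < K / \<eta>\<close>, logarithms give
  \<open>K \<le> 6 * ln (1 / \<eta>)\<close>, and inserting this into the former and squaring yields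
  the bound.\<close>

lemma zeta_threshold:
  assumes "0 < \<eta>" "\<eta> < 1 / 2"
  obtains K where "\<And>k. K \<le> k \<Longrightarrow> zeta k \<le> \<eta> / 2" "4 ^ K \<le> 36 * (ln (1 / \<eta>))\<^sup>2 / \<eta>\<^sup>2"
proof -
  define L where "L = ln (1 / \<eta>)"
  have "ln 2 \<le> L"
    using assms by (auto simp: L_def field_simps)
  then have L: "2 / 3 \<le> L"
    using ln2_ge_two_thirds by linarith
  have ex: "\<exists>k. zeta k \<le> \<eta> / 2"
  proof -
    have "(\<lambda>k. (of_nat k * (1 / 2) ^ k + (1 / 2) ^ k) / 4) \<longlonglongrightarrow> ((0 + 0) / 4 :: real)"
      by (intro tendsto_intros powser_times_n_limit_0 LIMSEQ_power_zero) auto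
    then have "zeta \<longlonglongrightarrow> 0"
      by (simp add: zeta_def[abs_def] power_one_over field_simps)
    then have "\<forall>\<^sub>F k in sequentially. zeta k < \<eta> / 2"
      using assms by (intro order_tendstoD) auto
    then show ?thesis
      by (metis eventually_sequentially less_imp_le order_refl)
  qed
  define K where "K = (LEAST k. zeta k \<le> \<eta> / 2)"
  have K: "zeta K \<le> \<eta> / 2"
    unfolding K_def by (rule LeastI_ex[OF ex])
  show thesis
  proof (rule that[of K])
    show "zeta k \<le> \<eta> / 2" if "K \<le> k" for k
      using zeta_antimono[OF that] K by linarith
    show "4 ^ K \<le> 36 * (ln (1 / \<eta>))\<^sup>2 / \<eta>\<^sup>2"
    proof (cases K)
      case 0
      have "(2 / 3)\<^sup>2 \<le> L\<^sup>2"
        using L by (intro power_mono) auto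
      moreover have "\<eta>\<^sup>2 \<le> 1"
        using assms by (intro power_le_one) auto
      ultimately show ?thesis
        using 0 assms by (simp add: field_simps L_def[symmetric])
    next
      case (Suc J)
      have "\<eta> / 2 < zeta J"
        using Suc not_less_Least[of J "\<lambda>k. zeta k \<le> \<eta> / 2"] by (auto simp: K_def)
      \<comment> \<open>For \<open>K = Suc J\<close> the value \<open>zeta J\<close> equals
        \<open>K / (2 * 2 ^ K)\<close>.\<close>
      then have 2: "2 ^ K < K / \<eta>"
        using assms Suc by (simp add: zeta_def field_simps)
      have Kp: "0 < K"
        using Suc by simp
      have "ln (2 ^ K) < ln (K / \<eta>)"
        using 2 by (subst ln_less_cancel_iff) (use assms Kp in auto)
      then have "K * ln 2 < ln K + L"
        using assms Kp by (simp add: L_def ln_realpow ln_div)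
      \<comment> \<open>Applied to \<open>K / 2\<close>, the linear bound gives
        \<open>ln K < K / 2\<close>, against \<open>K * ln 2 \<ge> K * (2 / 3)\<close>; the
        difference \<open>K / 6\<close> produces the constant 6.\<close>
      moreover have "ln (real K / 2) \<le> real K / 2 - 1"
        using Kp by (intro ln_le_minus_one) auto
      moreover have "K * (2 / 3) \<le> K * ln 2"
        using ln2_ge_two_thirds by (intro mult_left_mono) auto
      moreover have "ln (2::real) < 1"
        by (rule ln_2_less_1)
      moreover have "ln (real K / 2) = ln K - ln 2"
        using Kp by (simp add: ln_div)
      ultimately have "K \<le> 6 * L"
        by linarith
      then have "K / \<eta> \<le> 6 * L / \<eta>"
        using assms by (intro divide_right_mono) auto
      with 2 have "(2 ^ K)\<^sup>2 \<le> (6 * L / \<eta>)\<^sup>2"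
        by (intro power_mono) auto
      then show ?thesis
        by (simp add: power_mult_distrib power_divide L_def power2_eq_square flip: power_mult_distrib)
    qed
  qed
qed

lemma uniform_entropy_bumps:
  assumes "0 < \<eta>" "\<eta> < 1"
  shows "uniform_entropy \<eta> bumps \<le> ereal (60 / \<eta> powr 2 * ln (1 / \<eta>) powr 2)"
  unfolding uniform_entropy_def
proof (intro SUP_least)
  fix Q :: "real pmf" and G
  assume "Q \<in> {Q. finite (set_pmf Q) \<and> set_pmf Q \<subseteq> {0..1}}" "G \<in> Pow bumps"
  then have Q: "finite (set_pmf Q)" and G: "G \<subseteq> bumps"
    by auto
  let ?N = "ln_enat (covering_number (\<eta> * norm2 (measure_pmf Q) (envelope G)) G (norm2 (measure_pmf Q)))"
  define L where "L = ln (1 / \<eta>)"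
  have L0: "0 < L"
    using assms by (simp add: L_def)
  have rhs: "60 / \<eta> powr 2 * ln (1 / \<eta>) powr 2 = 60 * L\<^sup>2 / \<eta>\<^sup>2"
    using assms L0 by (simp add: L_def)
  show "?N \<le> ereal (60 / \<eta> powr 2 * ln (1 / \<eta>) powr 2)"
  proof (cases "1 / 2 \<le> \<eta>")
    case True
    have "?N \<le> ereal 0"
      using ln_covering_coarse[OF Q G True] by (simp add: zero_ereal_def)
    also have "\<dots> \<le> ereal (60 * L\<^sup>2 / \<eta>\<^sup>2)"
      by simp
    finally show ?thesis
      by (simp only: rhs)
  next
    case False
    then have \<eta>: "\<eta> < 1 / 2" by simp
    obtain K where K: "\<And>k. K \<le> k \<Longrightarrow> zeta k \<le> \<eta> / 2" "4 ^ K \<le> 36 * L\<^sup>2 / \<eta>\<^sup>2"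
      using zeta_threshold[OF assms(1) \<eta>] unfolding L_def by metis
    have "ln 2 \<le> L"
      using assms \<eta> by (auto simp: L_def field_simps)
    then have L: "2 / 3 \<le> L"
      using ln2_ge_two_thirds by linarith
    have "ln (17 :: real) \<le> ln (2 ^ 5)"
      by (subst ln_le_cancel_iff) auto
    also have "\<dots> \<le> 5"
      using ln_2_less_1 by (simp only: ln_realpow)
    finally have "ln (17 / \<eta>\<^sup>2) \<le> 5 + 2 * L"
      using assms by (simp add: L_def ln_div ln_realpow)
    moreover have "1 \<le> 9 / 4 * L\<^sup>2" "L \<le> 3 / 2 * L\<^sup>2"
      using power_mono[OF L, of 2] mult_right_mono[OF L, of L] L
      by (auto simp: power2_eq_square)
    \<comment> \<open>The lower-order part is at most \<open>6 + 2 * L\<close>, and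
      \<open>L \<ge> 2 / 3\<close> turns it into at most \<open>24 * L\<^sup>2\<close>. Together
      with the 36 from the threshold this makes 60.\<close>
    ultimately have "ln (17 / \<eta>\<^sup>2) + (4 ^ K + 1) \<le> 24 * L\<^sup>2 + 36 * L\<^sup>2 / \<eta>\<^sup>2"
      using K(2) by linarith
    also have "24 * L\<^sup>2 \<le> 24 * L\<^sup>2 / \<eta>\<^sup>2"
      using assms by (simp add: le_divide_eq mult_right_le_one_le power_le_one)
    finally have "ln (17 / \<eta>\<^sup>2) + (4 ^ K + 1) \<le> 60 * L\<^sup>2 / \<eta>\<^sup>2"
      by simp
    then show ?thesis
      using ln_covering_fine[OF Q G assms(1) _ K(1)] assms(2)
      by (simp only: rhs) (meson ereal_less_eq(3) less_imp_le order_trans)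
  qed
qed

section \<open>Sums of independent copies and the error law\<close>

lemma integral_PiM_component:
  fixes f :: "'a \<Rightarrow> real"
  assumes "prob_space M" "i \<in> I" "f \<in> borel_measurable M"
  shows "(\<integral>d. f (d i) \<partial>PiM I (\<lambda>_. M)) = integral\<^sup>L M f"
    "integrable (PiM I (\<lambda>_. M)) (\<lambda>d. f (d i)) \<longleftrightarrow> integrable M f"
proof -
  have *: "distr (PiM I (\<lambda>_. M)) M (\<lambda>d. d i) = M"
    using assms by (intro distr_PiM_component) auto
  have "(\<lambda>d. d i) \<in> PiM I (\<lambda>_. M) \<rightarrow>\<^sub>M M"
    using assms by measurable
  from integral_distr[OF this assms(3)] integrable_distr_eq[OF this assms(3)]
  show "(\<integral>d. f (d i) \<partial>PiM I (\<lambda>_. M)) = integral\<^sup>L M f"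
    "integrable (PiM I (\<lambda>_. M)) (\<lambda>d. f (d i)) \<longleftrightarrow> integrable M f"
    by (simp_all add: *)
qed

text \<open>The product of two coordinates is read as a product over all of \<open>I\<close> with
  the constant 1 at the remaining coordinates, so that the integral factorizes.\<close>

lemma integral_PiM_two_components:
  fixes f :: "'a \<Rightarrow> real"
  assumes "prob_space M" "finite I" "i \<in> I" "j \<in> I" "i \<noteq> j" "integrable M f"
  shows "(\<integral>d. f (d i) * f (d j) \<partial>PiM I (\<lambda>_. M)) = (integral\<^sup>L M f)\<^sup>2"
    "integrable (PiM I (\<lambda>_. M)) (\<lambda>d. f (d i) * f (d j))"
proof -
  interpret prob_space M by fact
  interpret product_sigma_finite "\<lambda>_. M" ..
  define h where "h l = (if l \<in> {i, j} then f else (\<lambda>_. 1))" for l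
  have int: "integrable M (h l)" for l
    using assms by (simp add: h_def)
  have prod: "(\<Prod>l\<in>I. if l \<in> {i, j} then c l else 1) = c i * c j" for c :: "_ \<Rightarrow> real"
  proof -
    have "(\<Prod>l\<in>I. if l \<in> {i, j} then c l else 1) = (\<Prod>l\<in>I \<inter> {i, j}. c l)"
      by (rule prod.inter_restrict[OF assms(2), symmetric])
    also have "I \<inter> {i, j} = {i, j}"
      using assms by auto
    finally show ?thesis
      using assms by simp
  qed
  have eq: "(\<Prod>l\<in>I. h l (d l)) = f (d i) * f (d j)" for d
    using prod[of "\<lambda>l. f (d l)"] by (simp add: h_def if_distrib[of "\<lambda>g. g _"] cong: if_cong)
  have eq': "(\<Prod>l\<in>I. integral\<^sup>L M (h l)) = integral\<^sup>L M f * integral\<^sup>L M f"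
    using prod[of "\<lambda>_. integral\<^sup>L M f"]
    by (simp add: h_def if_distrib[of "integral\<^sup>L M"] prob_space cong: if_cong)
  show "(\<integral>d. f (d i) * f (d j) \<partial>PiM I (\<lambda>_. M)) = (integral\<^sup>L M f)\<^sup>2"
    using product_integral_prod[of I h] int assms(2) by (simp add: eq eq' power2_eq_square)
  show "integrable (PiM I (\<lambda>_. M)) (\<lambda>d. f (d i) * f (d j))"
    using product_integrable_prod[of I h] int assms(2) by (simp add: eq)
qed

text \<open>The square expands into a double sum: diagonal terms contribute the second moment of
  \<open>f\<close>, off-diagonal ones the square of its mean.\<close>

lemma iid_sum_moments:
  fixes f :: "'a \<Rightarrow> real" and n :: nat and \<mu> :: real
  assumes M: "prob_space M" and f: "f \<in> borel_measurable M" "integrable M (\<lambda>x. (f x)\<^sup>2)"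
  defines "P \<equiv> PiM {..<n} (\<lambda>_. M)" and "\<mu> \<equiv> integral\<^sup>L M f" and "S \<equiv> \<lambda>d. \<Sum>i<n. f (d i)"
  shows "integrable P S" "integral\<^sup>L P S = n * \<mu>"
    "integrable P (\<lambda>d. (S d)\<^sup>2)"
    "(\<integral>d. (S d)\<^sup>2 \<partial>P) = n * (\<integral>x. (f x)\<^sup>2 \<partial>M) + n * (n - 1) * \<mu>\<^sup>2"
proof -
  interpret prob_space M by fact
  have int: "integrable M f"
    by (rule square_integrable_imp_integrable[OF f])
  have comp: "integral\<^sup>L P (\<lambda>d. f (d i)) = \<mu>" "integrable P (\<lambda>d. f (d i))" if "i < n" for i
    using that f(1) M int unfolding P_def \<mu>_def by (simp_all add: integral_PiM_component)
  show "integrable P S" "integral\<^sup>L P S = n * \<mu>"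
    using Bochner_Integration.integrable_sum[of "{..<n}" P "\<lambda>i d. f (d i)"]
      Bochner_Integration.integral_sum[of "{..<n}" P "\<lambda>i d. f (d i)"]
    by (simp_all add: S_def comp)
  let ?V = "\<integral>x. (f x)\<^sup>2 \<partial>M"
  have sq: "(S d)\<^sup>2 = (\<Sum>i<n. \<Sum>j<n. f (d i) * f (d j))" for d
    by (simp add: S_def power2_eq_square sum_product)
  have pair: "integrable P (\<lambda>d. f (d i) * f (d j))"
      "(\<integral>d. f (d i) * f (d j) \<partial>P) = \<mu>\<^sup>2 + (if i = j then ?V - \<mu>\<^sup>2 else 0)"
    if "i < n" "j < n" for i j
  proof -
    have "integrable P (\<lambda>d. f (d i) * f (d j)) \<and>
      (\<integral>d. f (d i) * f (d j) \<partial>P) = \<mu>\<^sup>2 + (if i = j then ?V - \<mu>\<^sup>2 else 0)"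
    proof (cases "i = j")
      case True
      have "(\<lambda>x. (f x)\<^sup>2) \<in> borel_measurable M"
        using f by measurable
      from integral_PiM_component[OF M _ this, of i "{..<n}"] show ?thesis
        using True that f(2) unfolding P_def by (simp add: power2_eq_square)
    next
      case False
      then show ?thesis
        using integral_PiM_two_components[OF M, of "{..<n}" i j f] that int
        unfolding P_def \<mu>_def by auto
    qed
    then show "integrable P (\<lambda>d. f (d i) * f (d j))"
      "(\<integral>d. f (d i) * f (d j) \<partial>P) = \<mu>\<^sup>2 + (if i = j then ?V - \<mu>\<^sup>2 else 0)"
      by auto
  qed
  show "integrable P (\<lambda>d. (S d)\<^sup>2)"
    unfolding sq by (intro Bochner_Integration.integrable_sum) (simp add: pair)
  have "(\<integral>d. (S d)\<^sup>2 \<partial>P) = (\<Sum>i<n. \<Sum>j<n. \<mu>\<^sup>2 + (if i = j then ?V - \<mu>\<^sup>2 else 0))"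
  proof -
    have "(\<integral>d. (\<Sum>i<n. \<Sum>j<n. f (d i) * f (d j)) \<partial>P) = (\<Sum>i<n. \<integral>d. (\<Sum>j<n. f (d i) * f (d j)) \<partial>P)"
      by (intro Bochner_Integration.integral_sum Bochner_Integration.integrable_sum) (simp add: pair)
    also have "\<dots> = (\<Sum>i<n. \<Sum>j<n. \<integral>d. f (d i) * f (d j) \<partial>P)"
      by (intro sum.cong refl Bochner_Integration.integral_sum) (simp add: pair)
    finally show ?thesis
      unfolding sq by (simp add: pair)
  qed
  also have "\<dots> = n * (n * \<mu>\<^sup>2 + (?V - \<mu>\<^sup>2))"
    by (simp add: sum.distrib)
  also have "\<dots> = n * ?V + n * (n - 1) * \<mu>\<^sup>2"
    by (cases n) (simp_all add: algebra_simps)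
  finally show "(\<integral>d. (S d)\<^sup>2 \<partial>P) = n * ?V + n * (n - 1) * \<mu>\<^sup>2" .
qed

text \<open>The variance is bounded by the raw second moment, which is explicit in both
  applications: a measure for indicators, a level variance for the noise.\<close>

lemma iid_chebyshev:
  fixes f :: "'a \<Rightarrow> real" and n :: nat
  assumes M: "prob_space M" and f: "f \<in> borel_measurable M" "integrable M (\<lambda>x. (f x)\<^sup>2)" and a: "0 < a"
  defines "P \<equiv> PiM {..<n} (\<lambda>_. M)"
  shows "measure P {d \<in> space P. a \<le> \<bar>(\<Sum>i<n. f (d i)) - n * integral\<^sup>L M f\<bar>}
    \<le> n * (\<integral>x. (f x)\<^sup>2 \<partial>M) / a\<^sup>2"
proof -
  interpret P: prob_space P
    unfolding P_def using M by (intro prob_space_PiM)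
  let ?\<mu> = "integral\<^sup>L M f" and ?V = "\<integral>x. (f x)\<^sup>2 \<partial>M"
  define S where "S d = (\<Sum>i<n. f (d i))" for d
  note mom = iid_sum_moments[OF M f, of n, folded P_def, folded S_def]
  have sq: "(S d - n * ?\<mu>)\<^sup>2 = (S d)\<^sup>2 - 2 * n * ?\<mu> * S d + (n * ?\<mu>)\<^sup>2" for d
    by (simp add: power2_diff)
  have int: "integrable P (\<lambda>d. (S d - n * ?\<mu>)\<^sup>2)"
    unfolding sq using mom by simp
  have "(\<integral>d. (S d - n * ?\<mu>)\<^sup>2 \<partial>P) = n * ?V + n * (n - 1) * ?\<mu>\<^sup>2 - 2 * n * ?\<mu> * (n * ?\<mu>) + (n * ?\<mu>)\<^sup>2"
    unfolding sq using mom by (simp add: P.prob_space)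
  also have "\<dots> = n * ?V - n * ?\<mu>\<^sup>2"
    by (cases n) (simp_all add: algebra_simps power2_eq_square)
  also have "\<dots> \<le> n * ?V"
    by simp
  finally have le: "(\<integral>d. (S d - n * ?\<mu>)\<^sup>2 \<partial>P) \<le> n * ?V" .
  have "measure P {d \<in> space P. a \<le> \<bar>S d - n * ?\<mu>\<bar>} \<le> (\<integral>d. (S d - n * ?\<mu>)\<^sup>2 \<partial>P) / a\<^sup>2"
    using mom(1) by (intro P.second_moment_method int a) auto
  also have "\<dots> \<le> n * ?V / a\<^sup>2"
    using le by (intro divide_right_mono) auto
  finally show ?thesis
    by (simp add: S_def)
qed

section \<open>The error law\<close>

definition noise_scale :: "real \<Rightarrow> real" where
  "noise_scale x = (\<Sum>k. 4 / zeta k * indicator (lvl k) x)"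

text \<open>The sign is independent of the design point, which centres the error conditionally; its
  magnitude is a deterministic function of the design point.\<close>

definition noise_law :: "(real \<times> real) measure" where
  "noise_law = distr (unif01 \<Otimes>\<^sub>M measure_pmf (pmf_of_set {-1, 1 :: real})) (unif01 \<Otimes>\<^sub>M borel)
     (\<lambda>z. (fst z, snd z * noise_scale (fst z)))"

lemma noise_scale_lvl: "x \<in> lvl k \<Longrightarrow> noise_scale x = 4 / zeta k"
proof -
  assume x: "x \<in> lvl k"
  have "(\<lambda>j. 4 / zeta j * indicator (lvl j) x) = (\<lambda>j. if j = k then 4 / zeta k else 0)"
    using x lvl_disjoint by (auto simp: indicator_def fun_eq_iff)
  then show ?thesis
    unfolding noise_scale_def using sums_single[of k "\<lambda>_. 4 / zeta k"] by (simp add: sums_iff)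
qed

lemma noise_scale_outside: "(\<And>k. x \<notin> lvl k) \<Longrightarrow> noise_scale x = 0"
  by (simp add: noise_scale_def)

lemma noise_scale_nonneg: "0 \<le> noise_scale x"
proof (cases "\<exists>k. x \<in> lvl k")
  case True
  then show ?thesis
    using noise_scale_lvl zeta_pos by (auto simp: less_imp_le)
next
  case False
  then show ?thesis
    by (simp add: noise_scale_outside)
qed

lemma noise_scale_measurable_borel [measurable]: "noise_scale \<in> borel_measurable borel"
  unfolding noise_scale_def by measurable

lemma lvl_sets_unif01 [measurable]: "lvl k \<in> sets unif01"
  using lvl_01 by (intro sets_unif01_borel) auto

lemma noise_scale_measurable [measurable]: "noise_scale \<in> borel_measurable unif01"
  by (intro borel_measurable_unif01I) measurable

text \<open>The power of 4 in the squared noise level cancels against the measure of the level,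
  leaving only the summable factor.\<close>

lemma noise_variance_lvl: "(4 / zeta k)\<^sup>2 * measure unif01 (lvl k) = 192 / (real (k + 1))\<^sup>2"
proof -
  have "((2::real) ^ k)\<^sup>2 = 4 ^ k"
    by (simp add: power2_eq_square flip: power_mult_distrib)
  then have "(4 / zeta k)\<^sup>2 = 256 * 4 ^ k / (real (k + 1))\<^sup>2"
    by (simp add: zeta_def power_divide power_mult_distrib)
  then show ?thesis
    by (simp add: measure_lvl)
qed

text \<open>The levels are disjoint, so the square is a series of their contributions. It may be
  integrated term by term, and the resulting inverse squares have a finite sum.\<close>

lemma integrable_noise_scale: "integrable unif01 (\<lambda>x. (noise_scale x)\<^sup>2)"
proof (rule integrableI_bounded)
  interpret prob_space unif01 by (rule prob_space_unif01)
  have *: "ennreal (norm ((noise_scale x)\<^sup>2)) = (\<Sum>k. ennreal ((4 / zeta k)\<^sup>2) * indicator (lvl k) x)" for x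
  proof (cases "\<exists>k. x \<in> lvl k")
    case True
    then obtain k where k: "x \<in> lvl k" by blast
    have "(\<lambda>j. ennreal ((4 / zeta j)\<^sup>2) * indicator (lvl j) x)
        = (\<lambda>j. if j = k then ennreal ((4 / zeta k)\<^sup>2) else 0)"
      using k lvl_disjoint by (auto simp: indicator_def fun_eq_iff)
    then show ?thesis
      using sums_single[of k "\<lambda>_. ennreal ((4 / zeta k)\<^sup>2)"] noise_scale_lvl[OF k]
      by (simp add: sums_iff)
  next
    case False
    then show ?thesis
      by (simp add: noise_scale_outside)
  qed
  have "(\<integral>\<^sup>+x. ennreal (norm ((noise_scale x)\<^sup>2)) \<partial>unif01)
      = (\<Sum>k. \<integral>\<^sup>+x. ennreal ((4 / zeta k)\<^sup>2) * indicator (lvl k) x \<partial>unif01)"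
    unfolding * by (intro nn_integral_suminf) auto
  also have "\<dots> = (\<Sum>k. ennreal (192 / (real (k + 1))\<^sup>2))"
    by (subst noise_variance_lvl[symmetric])
       (auto simp: nn_integral_cmult_indicator emeasure_eq_measure ennreal_mult simp del: of_nat_add)
  also have "\<dots> < \<infinity>"
  proof -
    have "summable (\<lambda>k. 192 * (1 / (real (k + 1))\<^sup>2))"
      using inverse_squares_sums by (intro summable_mult) (simp add: sums_iff add.commute)
    then have "(\<Sum>k. ennreal (192 / (real (k + 1))\<^sup>2)) = ennreal (\<Sum>k. 192 / (real (k + 1))\<^sup>2)"
      by (intro suminf_ennreal2) auto
    then show ?thesis
      by simp
  qed
  finally show "(\<integral>\<^sup>+x. ennreal (norm ((noise_scale x)\<^sup>2)) \<partial>unif01) < \<infinity>" .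
qed measurable

abbreviation coin :: "real measure" where
  "coin \<equiv> measure_pmf (pmf_of_set {-1, 1})"

lemma pair_prob_space_coin: "pair_prob_space unif01 coin"
  by (simp add: pair_prob_space_def pair_sigma_finite_def prob_space_unif01 prob_space_measure_pmf
      prob_space_imp_sigma_finite)

lemma coin_measurable [measurable]: "(\<lambda>z. snd z) \<in> borel_measurable (unif01 \<Otimes>\<^sub>M coin)"
  by (rule measurable_compose[OF measurable_snd]) simp

lemma noise_map_measurable [measurable]:
  "(\<lambda>z. (fst z, snd z * noise_scale (fst z))) \<in> unif01 \<Otimes>\<^sub>M coin \<rightarrow>\<^sub>M unif01 \<Otimes>\<^sub>M borel"
  by measurable

lemma sets_noise_law [measurable_cong]: "sets noise_law = sets (unif01 \<Otimes>\<^sub>M borel)"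
  by (simp add: noise_law_def)

lemma space_noise_law: "space noise_law = {0..1} \<times> UNIV"
  by (simp add: noise_law_def space_pair_measure)

lemma prob_space_noise_law: "prob_space noise_law"
proof -
  interpret pair_prob_space unif01 coin by (rule pair_prob_space_coin)
  show ?thesis
    unfolding noise_law_def by (rule prob_space_distr) measurable
qed

lemma distr_noise_law_fst: "distr noise_law unif01 fst = unif01"
proof -
  have "distr noise_law unif01 fst = distr (unif01 \<Otimes>\<^sub>M coin) unif01 fst"
    unfolding noise_law_def
    by (subst distr_distr) (auto simp: comp_def intro!: distr_cong)
  then show ?thesis
    by (simp add: prob_space.distr_pair_fst[OF prob_space_measure_pmf])
qed

lemma integral_noise_law_fst:
  fixes \<phi> :: "real \<Rightarrow> real"
  assumes "\<phi> \<in> borel_measurable unif01"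
  shows "(\<integral>z. \<phi> (fst z) \<partial>noise_law) = integral\<^sup>L unif01 \<phi>"
    "integrable noise_law (\<lambda>z. \<phi> (fst z)) \<longleftrightarrow> integrable unif01 \<phi>"
proof -
  have "fst \<in> noise_law \<rightarrow>\<^sub>M unif01"
    by measurable
  from integral_distr[OF this assms] integrable_distr_eq[OF this assms]
  show "(\<integral>z. \<phi> (fst z) \<partial>noise_law) = integral\<^sup>L unif01 \<phi>"
    "integrable noise_law (\<lambda>z. \<phi> (fst z)) \<longleftrightarrow> integrable unif01 \<phi>"
    by (simp_all add: distr_noise_law_fst)
qed

text \<open>The deterministic estimates of the gain assume this identity at every sample point; it
  holds almost surely because the coin has absolute value 1.\<close>

lemma AE_noise_law_abs: "AE z in noise_law. \<bar>snd z\<bar> = noise_scale (fst z)"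
proof -
  interpret pair_prob_space unif01 coin by (rule pair_prob_space_coin)
  have "AE z in unif01 \<Otimes>\<^sub>M coin. \<bar>snd z\<bar> = 1"
  proof (rule AE_pair_measure)
    show "AE x in unif01. AE \<sigma> in coin. \<bar>snd (x, \<sigma>)\<bar> = 1"
      by (intro always_eventually allI AE_pmfI) auto
  qed measurable
  then have "AE z in unif01 \<Otimes>\<^sub>M coin. \<bar>snd z * noise_scale (fst z)\<bar> = noise_scale (fst z)"
    by eventually_elim (simp add: abs_mult noise_scale_nonneg)
  moreover have "{z \<in> space (unif01 \<Otimes>\<^sub>M borel). \<bar>snd z\<bar> = noise_scale (fst z)} \<in> sets (unif01 \<Otimes>\<^sub>M borel)"
    by measurable
  ultimately show ?thesis
    unfolding noise_law_def using AE_distr_iff[OF noise_map_measurable] by simp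
qed

lemma integrable_noise_square: "integrable noise_law (\<lambda>z. (snd z)\<^sup>2)"
proof -
  have "integrable noise_law (\<lambda>z. (noise_scale (fst z))\<^sup>2)"
    by (subst integral_noise_law_fst(2)[of "\<lambda>x. (noise_scale x)\<^sup>2"]) (auto simp: integrable_noise_scale)
  moreover have "AE z in noise_law. (noise_scale (fst z))\<^sup>2 = (snd z)\<^sup>2"
    using AE_noise_law_abs by eventually_elim (metis power2_abs)
  ultimately show ?thesis
    using integrable_cong_AE[of "\<lambda>z. (noise_scale (fst z))\<^sup>2" noise_law "\<lambda>z. (snd z)\<^sup>2"] by simp
qed

text \<open>Integrating over the sign first gives 0 for every design point. Indicators as \<phi>
  yield both the conditional centring of the error and the zero mean of the noise on a
  level.\<close>

lemma integral_noise_weighted: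
  fixes \<phi> :: "real \<Rightarrow> real"
  assumes [measurable]: "\<phi> \<in> borel_measurable unif01" and \<phi>: "\<And>x. \<bar>\<phi> x\<bar> \<le> 1"
  shows "integrable noise_law (\<lambda>z. snd z * \<phi> (fst z))"
    "(\<integral>z. snd z * \<phi> (fst z) \<partial>noise_law) = 0"
proof -
  interpret pair_prob_space unif01 coin by (rule pair_prob_space_coin)
  interpret D: prob_space noise_law by (rule prob_space_noise_law)
  have snd: "integrable noise_law snd"
    by (rule D.square_integrable_imp_integrable) (use integrable_noise_square in auto)
  show int: "integrable noise_law (\<lambda>z. snd z * \<phi> (fst z))"
    by (rule Bochner_Integration.integrable_bound[OF snd])
       (auto simp: abs_mult mult_left_le \<phi>)
  have meas: "(\<lambda>z. snd z * \<phi> (fst z)) \<in> borel_measurable (unif01 \<Otimes>\<^sub>M borel)"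
    by measurable
  have int2: "integrable (unif01 \<Otimes>\<^sub>M coin) (\<lambda>z. snd z * noise_scale (fst z) * \<phi> (fst z))"
    using int integrable_distr_eq[OF noise_map_measurable meas] by (simp add: noise_law_def)
  have "(\<integral>z. snd z * \<phi> (fst z) \<partial>noise_law) = (\<integral>z. snd z * noise_scale (fst z) * \<phi> (fst z) \<partial>(unif01 \<Otimes>\<^sub>M coin))"
    using integral_distr[OF noise_map_measurable meas] by (simp add: noise_law_def)
  also have "\<dots> = (\<integral>x. (\<integral>\<sigma>. \<sigma> * noise_scale x * \<phi> x \<partial>coin) \<partial>unif01)"
    using integral_fst'[OF int2] by simp
  also have "\<dots> = 0"
    by (subst integral_pmf_of_set) auto
  finally show "(\<integral>z. snd z * \<phi> (fst z) \<partial>noise_law) = 0" .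
qed

text \<open>The sets of the algebra generated by the first coordinate are preimages of sets
  \<open>A\<close>. The error integrates to 0 over each of them by
  \<open>integral_noise_weighted\<close> with the indicator of \<open>A\<close>, which characterizes
  the conditional expectation as 0.\<close>

lemma error_law_noise_law: "error_law noise_law"
proof -
  interpret D: prob_space noise_law by (rule prob_space_noise_law)
  let ?G = "vimage_algebra (space noise_law) fst unif01"
  have fst: "fst \<in> space noise_law \<rightarrow> space unif01"
    by (auto simp: space_noise_law)
  have G: "sets ?G = {fst -` A \<inter> space noise_law | A. A \<in> sets unif01}"
    by (rule sets_vimage_algebra2[OF fst])
  have "fst \<in> noise_law \<rightarrow>\<^sub>M unif01"
    by measurable
  then have "subalgebra noise_law ?G"
    unfolding subalgebra_def G by (auto intro: measurable_sets)
  then interpret finite_measure_subalgebra noise_law ?G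
    by unfold_locales
  have "AE z in noise_law. real_cond_exp noise_law ?G snd z = 0"
  proof (rule real_cond_exp_charact)
    fix B assume "B \<in> sets ?G"
    then obtain A where A: "A \<in> sets unif01" "B = fst -` A \<inter> space noise_law"
      unfolding G by blast
    have "(\<integral>z\<in>B. snd z \<partial>noise_law) = (\<integral>z. snd z * indicator A (fst z) \<partial>noise_law)"
      unfolding set_lebesgue_integral_def A(2)
      by (intro Bochner_Integration.integral_cong) (auto simp: indicator_def)
    also have "\<dots> = 0"
      using A(1) by (intro integral_noise_weighted) (auto simp: indicator_def)
    finally show "(\<integral>z\<in>B. snd z \<partial>noise_law) = (\<integral>z\<in>B. 0 \<partial>noise_law)"
      by (simp add: set_lebesgue_integral_def)
  next
    show "integrable noise_law snd"
      by (rule D.square_integrable_imp_integrable) (use integrable_noise_square in auto)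
  qed auto
  then show ?thesis
    unfolding error_law_def
    using prob_space_noise_law sets_noise_law distr_noise_law_fst integrable_noise_square by blast
qed

lemma sample_law_noise_law: "sample_law (\<lambda>_. 0) noise_law n = PiM {..<n} (\<lambda>_. noise_law)"
proof -
  have "distr noise_law (unif01 \<Otimes>\<^sub>M borel) (\<lambda>(x, e). (x, 0 + e)) = noise_law"
    by (simp add: id_def distr_id2 sets_noise_law)
  then show ?thesis
    by (simp add: sample_law_def)
qed

section \<open>The gain in squared loss over the zero function\<close>

lemma squared_loss_measurable:
  assumes "f \<in> bumps"
  shows "(\<lambda>d. squared_loss n d f) \<in> borel_measurable (PiM {..<n} (\<lambda>_. noise_law))"
proof -
  have [measurable]: "f \<in> borel_measurable unif01"
    using assms by (intro borel_measurable_unif01I bumps_measurable_borel)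
  show ?thesis
    unfolding squared_loss_def by measurable
qed

text \<open>Beyond some level no design point occurs, and every bump there has the same loss as the
  zero function. A minimum over the infinite class is therefore attained for every sample.\<close>

lemma finite_squared_loss_bumps: "finite (squared_loss n d ` bumps)"
proof -
  have "\<forall>\<^sub>F k in sequentially. \<forall>i\<in>{..<n}. fst (d i) \<notin> lvl k"
    by (intro eventually_ball_finite ballI lvl_eventually_notin) auto
  then obtain K where K: "\<And>k i. K \<le> k \<Longrightarrow> i < n \<Longrightarrow> fst (d i) \<notin> lvl k"
    by (auto simp: eventually_sequentially)
  have "squared_loss n d (bump k W) = squared_loss n d (\<lambda>_. 0)" if "K \<le> k" for k W
    using K[OF that] by (simp add: squared_loss_def bump_def)
  note fine = this
  let ?B = "insert (\<lambda>_. 0) (\<Union>k<K. bump k ` Pow {..<4 ^ (k + 1)})"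
  have "squared_loss n d f \<in> squared_loss n d ` ?B" if "f \<in> bumps" for f
    using that
  proof (cases rule: bumps_cases)
    case 1
    then show ?thesis
      by simp
  next
    case (2 k W)
    show ?thesis
    proof (cases "K \<le> k")
      case True
      then show ?thesis
        using fine[of k W] 2 by simp
    next
      case False
      then have "f \<in> ?B"
        using 2 by auto
      then show ?thesis
        by (rule imageI)
    qed
  qed
  then have "squared_loss n d ` bumps \<subseteq> squared_loss n d ` ?B"
    by blast
  then show ?thesis
    by (rule finite_subset) auto
qed

text \<open>The estimator is the first minimizer in an enumeration of the class. Its existence keeps
  the lower bound over all estimators from being vacuous.\<close>

lemma least_squares_estimator_exists:
  "\<exists>fhat. least_squares_estimator bumps (\<lambda>_. 0) noise_law fhat"
proof -
  define enum where "enum = from_nat_into bumps"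
  have enum: "range enum = bumps"
    unfolding enum_def using zero_in_bumps countable_bumps by (intro range_from_nat_into) auto
  define best where "best n d m \<longleftrightarrow> (\<forall>m'. squared_loss n d (enum m) \<le> squared_loss n d (enum m'))"
    for n d m
  define fhat where "fhat n d = enum (LEAST m. best n d m)" for n d
  have ex: "\<exists>m. best n d m" for n d
  proof -
    have "Min (squared_loss n d ` bumps) \<in> squared_loss n d ` bumps"
      using finite_squared_loss_bumps zero_in_bumps by (intro Min_in) auto
    then obtain m where "Min (squared_loss n d ` bumps) = squared_loss n d (enum m)"
      using enum by (metis (no_types, lifting) imageE rangeE)
    then show ?thesis
      unfolding best_def using finite_squared_loss_bumps enum
      by (metis Min_le image_eqI rangeI)
  qed
  have "is_arg_min (squared_loss n d) (\<lambda>f. f \<in> bumps) (fhat n d)" for n d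
  proof -
    have "best n d (LEAST m. best n d m)"
      by (rule LeastI_ex[OF ex])
    then have le: "squared_loss n d (fhat n d) \<le> squared_loss n d (enum m)" for m
      by (simp add: best_def fhat_def)
    have "squared_loss n d (fhat n d) \<le> squared_loss n d f" if "f \<in> bumps" for f
      using le that enum by (metis rangeE)
    moreover have "fhat n d \<in> bumps"
      using enum by (auto simp: fhat_def)
    ultimately show ?thesis
      by (auto simp: is_arg_min_def not_less)
  qed
  moreover have "(\<lambda>d. norm2 unif01 (\<lambda>x. fhat n d x - 0)) \<in> borel_measurable (PiM {..<n} (\<lambda>_. noise_law))" for n
  proof -
    have "(\<lambda>d. squared_loss n d (enum m)) \<in> borel_measurable (PiM {..<n} (\<lambda>_. noise_law))" for m
      using enum by (intro squared_loss_measurable) auto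
    then have "Measurable.pred (PiM {..<n} (\<lambda>_. noise_law)) (\<lambda>d. best n d m)" for m
      unfolding best_def by (intro pred_intros_countable) (simp add: pred_def borel_measurable_le)
    \<comment> \<open>Being a minimizer is a countable conjunction of measurable comparisons, so the
      least such index is measurable with values in a countable space.\<close>
    then have "(\<lambda>d. LEAST m. best n d m) \<in> PiM {..<n} (\<lambda>_. noise_law) \<rightarrow>\<^sub>M count_space UNIV"
      by (rule measurable_Least)
    then have "(\<lambda>d. (\<lambda>m. norm2 unif01 (\<lambda>x. enum m x - 0)) (LEAST m. best n d m))
        \<in> borel_measurable (PiM {..<n} (\<lambda>_. noise_law))"
      by (rule measurable_compose) simp
    then show ?thesis
      by (simp add: fhat_def)
  qed
  ultimately have "least_squares_estimator bumps (\<lambda>_. 0) noise_law fhat"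
    unfolding least_squares_estimator_def sample_law_noise_law by blast
  then show ?thesis
    by blast
qed

section \<open>Design points and noise in the cells of a level\<close>

definition cell_set :: "nat \<Rightarrow> nat \<Rightarrow> real set" where
  "cell_set k j = {x \<in> lvl k. cell k x = j}"

definition design_sum :: "nat \<Rightarrow> (nat \<Rightarrow> real \<times> real) \<Rightarrow> real set \<Rightarrow> real" where
  "design_sum n d A = (\<Sum>i<n. indicator A (fst (d i)))"

definition noise_sum :: "nat \<Rightarrow> (nat \<Rightarrow> real \<times> real) \<Rightarrow> real set \<Rightarrow> real" where
  "noise_sum n d A = (\<Sum>i<n. snd (d i) * indicator A (fst (d i)))"

text \<open>Zero iff no cell of level \<open>k\<close> contains two design points.\<close>

definition collisions :: "nat \<Rightarrow> (nat \<Rightarrow> real \<times> real) \<Rightarrow> nat \<Rightarrow> real" where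
  "collisions n d k = (\<Sum>j<4 ^ (k + 1). (design_sum n d (cell_set k j))\<^sup>2 - design_sum n d (cell_set k j))"

lemma cell_less: "x \<in> lvl k \<Longrightarrow> cell k x < 4 ^ (k + 1)"
proof -
  assume x: "x \<in> lvl k"
  then have "x * 4 ^ (2 * k + 1) < 1 / 4 ^ k * 4 ^ (2 * k + 1)"
    by (intro mult_strict_right_mono) (auto simp: lvl_def)
  also have "\<dots> = 4 ^ (k + 1)"
  proof -
    have "(16::real) ^ k = 4 ^ k * 4 ^ k"
      by (simp flip: power_mult_distrib)
    then show ?thesis
      by (simp add: power_mult)
  qed
  finally have "\<lfloor>x * 4 ^ (2 * k + 1)\<rfloor> < 4 ^ (k + 1)"
    by (simp add: floor_less_iff)
  then have "int (nat \<lfloor>x * 4 ^ (2 * k + 1)\<rfloor>) < int (4 ^ (k + 1))"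
    using lvl_01[OF x] by simp
  then show ?thesis
    unfolding cell_def by (simp only: of_nat_less_iff)
qed

text \<open>The cells partition the level, so exactly one summand survives there. This converts sums
  over cells into sums over the sample.\<close>

lemma sum_cell_set: "(\<Sum>j<4 ^ (k + 1). c j * indicator (cell_set k j) x) = c (cell k x) * (indicator (lvl k) x :: real)"
proof (cases "x \<in> lvl k")
  case True
  then have "(\<Sum>j<4 ^ (k + 1). c j * indicator (cell_set k j) x) = (\<Sum>j<4 ^ (k + 1). if j = cell k x then c j else 0)"
    by (intro sum.cong) (auto simp: cell_set_def indicator_def)
  then show ?thesis
    using True cell_less[OF True] by simp
qed (simp add: cell_set_def)

lemma sum_design_cells: "(\<Sum>j<4 ^ (k + 1). design_sum n d (cell_set k j)) = design_sum n d (lvl k)"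
proof -
  have "(\<Sum>j<4 ^ (k + 1). design_sum n d (cell_set k j))
      = (\<Sum>i<n. \<Sum>j<4 ^ (k + 1). 1 * indicator (cell_set k j) (fst (d i)))"
    unfolding design_sum_def by (subst sum.swap) simp
  then show ?thesis
    by (simp only: sum_cell_set) (simp add: design_sum_def)
qed

lemma sum_noise_cells:
  "(\<Sum>j<4 ^ (k + 1). c j * noise_sum n d (cell_set k j))
    = (\<Sum>i<n. snd (d i) * c (cell k (fst (d i))) * indicator (lvl k) (fst (d i)))"
proof -
  have "(\<Sum>j<4 ^ (k + 1). c j * noise_sum n d (cell_set k j))
      = (\<Sum>i<n. \<Sum>j<4 ^ (k + 1). snd (d i) * (c j * indicator (cell_set k j) (fst (d i))))"
    unfolding noise_sum_def sum_distrib_left by (subst sum.swap) (simp add: algebra_simps)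
  then show ?thesis
    by (simp only: sum_cell_set mult.assoc flip: sum_distrib_left)
qed

lemma design_sum_card: "design_sum n d A = real (card {i. i < n \<and> fst (d i) \<in> A})"
proof -
  have "design_sum n d A = (\<Sum>i\<in>{..<n}. if fst (d i) \<in> A then 1 else 0)"
    unfolding design_sum_def by (intro sum.cong) (auto simp: indicator_def)
  also have "\<dots> = (\<Sum>i\<in>{i \<in> {..<n}. fst (d i) \<in> A}. 1)"
    by (rule sum.inter_filter[symmetric]) simp
  finally show ?thesis
    by (simp add: lessThan_def)
qed

text \<open>A natural number never exceeds its square. Nonnegativity is what Markov's inequality
  asks for later.\<close>

lemma collisions_nonneg: "0 \<le> collisions n d k"
  unfolding collisions_def
proof (intro sum_nonneg)
  show "0 \<le> (design_sum n d (cell_set k j))\<^sup>2 - design_sum n d (cell_set k j)" for j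
  proof -
    have "c \<le> c\<^sup>2" for c :: nat
      by (cases c) (auto simp: power2_eq_square)
    then have "real c \<le> (real c)\<^sup>2" for c
      by (metis of_nat_le_iff of_nat_power)
    then show ?thesis
      by (simp add: design_sum_card)
  qed
qed

text \<open>A cell containing exactly one design point contributes its full noise level; for two or more
  points the bound is trivial.\<close>

lemma noise_cell_lower:
  assumes "\<And>i. i < n \<Longrightarrow> \<bar>snd (d i)\<bar> = noise_scale (fst (d i))"
  shows "4 / zeta k * (2 * design_sum n d (cell_set k j) - (design_sum n d (cell_set k j))\<^sup>2)
    \<le> \<bar>noise_sum n d (cell_set k j)\<bar>"
proof -
  let ?A = "{i. i < n \<and> fst (d i) \<in> cell_set k j}"
  have eq: "noise_sum n d (cell_set k j) = (\<Sum>i\<in>?A. snd (d i))"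
  proof -
    have "noise_sum n d (cell_set k j) = (\<Sum>i\<in>{..<n}. if fst (d i) \<in> cell_set k j then snd (d i) else 0)"
      unfolding noise_sum_def by (intro sum.cong) (auto simp: indicator_def)
    also have "\<dots> = (\<Sum>i\<in>{i \<in> {..<n}. fst (d i) \<in> cell_set k j}. snd (d i))"
      by (rule sum.inter_filter[symmetric]) simp
    finally show ?thesis
      by (simp add: lessThan_def)
  qed
  consider "card ?A = 0" | "card ?A = 1" | "2 \<le> card ?A"
    by linarith
  then show ?thesis
  proof cases
    case 1
    show ?thesis
      unfolding design_sum_card 1 by simp
  next
    case 2
    then obtain i where i: "?A = {i}"
      by (auto simp: card_1_singleton_iff)
    then have "i < n" "fst (d i) \<in> lvl k"
      by (auto simp: cell_set_def)
    then have "\<bar>snd (d i)\<bar> = 4 / zeta k"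
      using assms noise_scale_lvl by simp
    then show ?thesis
      unfolding eq design_sum_card i by simp
  next
    case 3
    then have "real (card ?A) * (2 - real (card ?A)) \<le> 0"
      by (intro mult_nonneg_nonpos) auto
    then have "4 / zeta k * (2 * real (card ?A) - (real (card ?A))\<^sup>2) \<le> 0"
      using zeta_pos[of k] by (intro mult_nonneg_nonpos) (auto simp: power2_eq_square algebra_simps)
    then show ?thesis
      unfolding design_sum_card by linarith
  qed
qed

section \<open>Bounds for the gain of a bump\<close>

definition gain :: "nat \<Rightarrow> (nat \<Rightarrow> real \<times> real) \<Rightarrow> (real \<Rightarrow> real) \<Rightarrow> real" where
  "gain n d f = squared_loss n d (\<lambda>_. 0) - squared_loss n d f"

lemma gain_eq: "gain n d f = (\<Sum>i<n. 2 * snd (d i) * f (fst (d i)) - (f (fst (d i)))\<^sup>2)"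
  by (simp add: gain_def squared_loss_def power2_diff flip: sum_subtractf)

text \<open>Per design point the modulation times the error is at most
  \<open>zeta k * (4 / zeta k) = 4\<close>, which enters doubled; the subtracted square is
  dropped.\<close>

lemma gain_bump_upper:
  assumes "\<And>i. i < n \<Longrightarrow> \<bar>snd (d i)\<bar> = noise_scale (fst (d i))"
  shows "gain n d (bump k W) \<le> 2 * noise_sum n d (lvl k) + 8 * design_sum n d (lvl k)"
proof -
  have "gain n d (bump k W)
      \<le> (\<Sum>i<n. 2 * (snd (d i) * indicator (lvl k) (fst (d i))) + 8 * indicator (lvl k) (fst (d i)))"
    unfolding gain_eq
  proof (rule sum_mono)
    fix i assume i: "i \<in> {..<n}"
    show "2 * snd (d i) * bump k W (fst (d i)) - (bump k W (fst (d i)))\<^sup>2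
        \<le> 2 * (snd (d i) * indicator (lvl k) (fst (d i))) + 8 * indicator (lvl k) (fst (d i))"
    proof (cases "fst (d i) \<in> lvl k")
      case True
      define w :: real where "w = (if cell k (fst (d i)) \<in> W then 1 else - 1)"
      have abs: "\<bar>snd (d i)\<bar> = 4 / zeta k"
        using assms[of i] i noise_scale_lvl[OF True] by simp
      have "zeta k * w * snd (d i) \<le> \<bar>zeta k * w * snd (d i)\<bar>"
        by simp
      also have "\<dots> = 4"
        using zeta_pos[of k] by (simp add: abs_mult abs w_def)
      finally have "2 * snd (d i) * (1 + zeta k * w) \<le> 2 * snd (d i) + 8"
        by (simp add: algebra_simps)
      then have "2 * snd (d i) * (1 + zeta k * w) - (1 + zeta k * w)\<^sup>2 \<le> 2 * snd (d i) + 8"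
        using zero_le_power2[of "1 + zeta k * w"] by linarith
      then show ?thesis
        using True by (simp add: bump_def w_def)
    qed (simp add: bump_def)
  qed
  then show ?thesis
    by (simp only: sum.distrib noise_sum_def design_sum_def sum_distrib_left)
qed

text \<open>The pattern \<open>W\<close> follows the sign of the total noise in each cell. A point
  alone in its cell gains 8 from the modulation and pays at most 4 for the square; shared cells are
  charged to the collisions.\<close>

lemma gain_bump_lower:
  assumes "\<And>i. i < n \<Longrightarrow> \<bar>snd (d i)\<bar> = noise_scale (fst (d i))"
  obtains W where "W \<subseteq> {..<4 ^ (k + 1)}"
    "4 * design_sum n d (lvl k) - 8 * collisions n d k + 2 * noise_sum n d (lvl k) \<le> gain n d (bump k W)"
proof -
  define W where "W = {j. j < 4 ^ (k + 1) \<and> 0 < noise_sum n d (cell_set k j)}"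
  define w :: "nat \<Rightarrow> real" where "w j = (if j \<in> W then 1 else - 1)" for j
  let ?J = "{..<4 ^ (k + 1) :: nat}" and ?C = "\<lambda>j. design_sum n d (cell_set k j)"
  have "4 / zeta k * (\<Sum>j\<in>?J. 2 * ?C j - (?C j)\<^sup>2) = (\<Sum>j\<in>?J. 4 / zeta k * (2 * ?C j - (?C j)\<^sup>2))"
    by (rule sum_distrib_left)
  also have "\<dots> \<le> (\<Sum>j\<in>?J. w j * noise_sum n d (cell_set k j))"
  proof (rule sum_mono)
    fix j assume "j \<in> ?J"
    then have "w j * noise_sum n d (cell_set k j) = \<bar>noise_sum n d (cell_set k j)\<bar>"
      by (auto simp: w_def W_def)
    with noise_cell_lower[OF assms] show "4 / zeta k * (2 * ?C j - (?C j)\<^sup>2) \<le> w j * noise_sum n d (cell_set k j)"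
      by simp
  qed
  also have "\<dots> = (\<Sum>i<n. snd (d i) * w (cell k (fst (d i))) * indicator (lvl k) (fst (d i)))"
    by (rule sum_noise_cells)
  finally have main: "4 * (\<Sum>j\<in>?J. 2 * ?C j - (?C j)\<^sup>2)
      \<le> zeta k * (\<Sum>i<n. snd (d i) * w (cell k (fst (d i))) * indicator (lvl k) (fst (d i)))"
    using zeta_pos[of k] by (simp add: field_simps)
  have "(\<Sum>j\<in>?J. 2 * ?C j - (?C j)\<^sup>2) = (\<Sum>j\<in>?J. ?C j - ((?C j)\<^sup>2 - ?C j))"
    by (intro sum.cong) auto
  also have "\<dots> = design_sum n d (lvl k) - collisions n d k"
    by (simp only: sum_subtractf sum_design_cells collisions_def)
  finally have "8 * (design_sum n d (lvl k) - collisions n d k)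
      \<le> 2 * zeta k * (\<Sum>i<n. snd (d i) * w (cell k (fst (d i))) * indicator (lvl k) (fst (d i)))"
    using main by simp
  then have "4 * design_sum n d (lvl k) - 8 * collisions n d k + 2 * noise_sum n d (lvl k)
      \<le> 2 * zeta k * (\<Sum>i<n. snd (d i) * w (cell k (fst (d i))) * indicator (lvl k) (fst (d i)))
        + 2 * noise_sum n d (lvl k) - 4 * design_sum n d (lvl k)"
    by simp
  also have "\<dots> = (\<Sum>i<n. 2 * zeta k * (snd (d i) * w (cell k (fst (d i))) * indicator (lvl k) (fst (d i)))
        + 2 * (snd (d i) * indicator (lvl k) (fst (d i))) - 4 * indicator (lvl k) (fst (d i)))"
    by (simp only: sum_subtractf sum.distrib noise_sum_def design_sum_def sum_distrib_left)
  also have "\<dots> \<le> gain n d (bump k W)"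
    unfolding gain_eq
  proof (rule sum_mono)
    fix i assume "i \<in> {..<n}"
    let ?x = "fst (d i)"
    show "2 * zeta k * (snd (d i) * w (cell k ?x) * indicator (lvl k) ?x)
        + 2 * (snd (d i) * indicator (lvl k) ?x) - 4 * indicator (lvl k) ?x
        \<le> 2 * snd (d i) * bump k W ?x - (bump k W ?x)\<^sup>2"
    proof (cases "?x \<in> lvl k")
      case True
      have "(bump k W ?x)\<^sup>2 \<le> 2\<^sup>2"
        using bump_nonneg[of k W ?x] bump_le[of k W ?x] True by (intro power_mono) auto
      then show ?thesis
        using True by (simp add: bump_def w_def algebra_simps)
    qed (simp add: bump_def)
  qed
  finally show thesis
    using that[of W] by (auto simp: W_def)
qed

text \<open>On this event the minimizer cannot live on a level finer than \<open>k + 3\<close>: such a bump gains less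
  than the best bump on level \<open>k\<close>.\<close>

lemma norm2_minimizer_ge:
  assumes noise: "\<And>i. i < n \<Longrightarrow> \<bar>snd (d i)\<bar> = noise_scale (fst (d i))"
    and y: "0 < y"
    and design: "y / 2 < design_sum n d (lvl k)"
    and coll: "collisions n d k < y / 8"
    and fine: "design_sum n d {0..<1 / 4 ^ (k + 4)} < y / 16"
    and sums: "\<And>j. k \<le> j \<Longrightarrow> \<bar>noise_sum n d (lvl j)\<bar> < y / 16"
    and f: "is_arg_min (squared_loss n d) (\<lambda>f. f \<in> bumps) f"
  shows "sqrt 3 / (32 * 2 ^ k) \<le> norm2 unif01 f"
proof -
  obtain W where W: "W \<subseteq> {..<4 ^ (k + 1)}"
    "4 * design_sum n d (lvl k) - 8 * collisions n d k + 2 * noise_sum n d (lvl k) \<le> gain n d (bump k W)"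
    by (rule gain_bump_lower[OF noise])
  have "f \<in> bumps" and "squared_loss n d f \<le> squared_loss n d (bump k W)"
    using f bump_in_bumps[OF W(1)] by (auto simp: is_arg_min_def not_less)
  then have "gain n d (bump k W) \<le> gain n d f"
    by (simp add: gain_def)
  \<comment> \<open>The assumed bounds give 4 times \<open>y / 2\<close>, minus 8 times
    \<open>y / 8\<close>, minus 2 times \<open>y / 16\<close>.\<close>
  then have gain: "7 / 8 * y < gain n d f"
    using W(2) design coll sums[of k] by (simp add: abs_less_iff)
  from \<open>f \<in> bumps\<close> show ?thesis
  proof (cases rule: bumps_cases)
    case 1
    then show ?thesis
      using gain y by (simp add: gain_def)
  next
    case (2 j V)
    have "j < k + 4"
    proof (rule ccontr)
      assume "\<not> j < k + 4"
      then have j: "k + 4 \<le> j" by simp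
      have "(4::real) ^ (k + 4) \<le> 4 ^ j"
        using j by (intro power_increasing) auto
      then have "1 / 4 ^ j \<le> 1 / (4::real) ^ (k + 4)"
        by (intro divide_left_mono) auto
      then have "lvl j \<subseteq> {0..<1 / 4 ^ (k + 4)}"
        using lvl_01[of _ j] by (auto simp: lvl_def simp del: power_Suc)
      then have "design_sum n d (lvl j) \<le> design_sum n d {0..<1 / 4 ^ (k + 4)}"
        unfolding design_sum_def by (intro sum_mono) (auto simp: indicator_def)
      moreover have "gain n d f \<le> 2 * noise_sum n d (lvl j) + 8 * design_sum n d (lvl j)"
        unfolding 2(2) by (rule gain_bump_upper[OF noise])
      \<comment> \<open>A bump this fine gains less than \<open>(2 + 8) * y / 16\<close>, that is
        \<open>5 / 8 * y\<close>, below the required \<open>7 / 8 * y\<close>.\<close>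
      ultimately show False
        using gain y fine sums[of j] j by (simp add: abs_less_iff)
    qed
    \<comment> \<open>The three extra levels cost a factor 8, turning the 4 of
      \<open>norm2_bump_ge\<close> into 32.\<close>
    then have "(2::real) ^ j \<le> 2 ^ (k + 3)"
      by (intro power_increasing) auto
    then have "sqrt 3 / (32 * 2 ^ k) \<le> sqrt 3 / (4 * 2 ^ j)"
      by (intro divide_left_mono) (auto simp: power_add)
    then show ?thesis
      using norm2_bump_ge[of j V] 2 by simp
  qed
qed

section \<open>The probability of a large estimation error\<close>

abbreviation sample :: "nat \<Rightarrow> (nat \<Rightarrow> real \<times> real) measure" where
  "sample n \<equiv> PiM {..<n} (\<lambda>_. noise_law)"

lemma prob_space_sample: "prob_space (sample n)"
  by (intro prob_space_PiM prob_space_noise_law)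

section \<open>Moments and tail bounds for the sample sums\<close>

lemma indicator_noise_law:
  assumes [measurable]: "A \<in> sets unif01"
  defines "f \<equiv> \<lambda>z. indicator A (fst z) :: real"
  shows "f \<in> borel_measurable noise_law" "integrable noise_law (\<lambda>z. (f z)\<^sup>2)"
    "integral\<^sup>L noise_law f = measure unif01 A" "(\<integral>z. (f z)\<^sup>2 \<partial>noise_law) = measure unif01 A"
proof -
  interpret prob_space unif01 by (rule prob_space_unif01)
  have sq: "(\<lambda>z. (f z)\<^sup>2) = f"
    by (auto simp: f_def indicator_def)
  have ind: "(indicator A :: real \<Rightarrow> real) \<in> borel_measurable unif01"
    by measurable
  show "f \<in> borel_measurable noise_law"
    unfolding f_def by measurable
  show "integrable noise_law (\<lambda>z. (f z)\<^sup>2)"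
    unfolding sq unfolding f_def integral_noise_law_fst(2)[OF ind]
    by (rule integrable_const_bound[of _ 1]) (auto simp: indicator_def)
  show "integral\<^sup>L noise_law f = measure unif01 A"
    unfolding f_def integral_noise_law_fst(1)[OF ind] using sets.sets_into_space[OF assms(1)]
    by (simp add: Int_absorb2)
  then show "(\<integral>z. (f z)\<^sup>2 \<partial>noise_law) = measure unif01 A"
    unfolding sq .
qed

lemma design_sum_moments:
  fixes n :: nat
  assumes "A \<in> sets unif01"
  shows "integrable (sample n) (\<lambda>d. design_sum n d A)"
    "(\<integral>d. design_sum n d A \<partial>sample n) = n * measure unif01 A"
    "integrable (sample n) (\<lambda>d. (design_sum n d A)\<^sup>2)"
    "(\<integral>d. (design_sum n d A)\<^sup>2 \<partial>sample n)
      = n * measure unif01 A + n * (n - 1) * (measure unif01 A)\<^sup>2"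
  using iid_sum_moments[OF prob_space_noise_law indicator_noise_law(1,2)[OF assms], of n]
    indicator_noise_law(3,4)[OF assms]
  by (simp_all add: design_sum_def)

lemma prob_design_deviation:
  fixes n :: nat
  assumes "A \<in> sets unif01" "0 < a"
  shows "measure (sample n) {d \<in> space (sample n). a \<le> \<bar>design_sum n d A - n * measure unif01 A\<bar>}
    \<le> n * measure unif01 A / a\<^sup>2"
  using iid_chebyshev[OF prob_space_noise_law indicator_noise_law(1,2)[OF assms(1)] assms(2), of n]
    indicator_noise_law(3,4)[OF assms(1)]
  by (simp add: design_sum_def)

lemma prob_design_large:
  fixes n :: nat
  assumes "A \<in> sets unif01" "0 < a"
  shows "measure (sample n) {d \<in> space (sample n). a \<le> design_sum n d A} \<le> n * measure unif01 A / a"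
proof -
  have "measure (sample n) {d \<in> space (sample n). a \<le> design_sum n d A}
      \<le> (\<integral>d. design_sum n d A \<partial>sample n) / a"
    by (rule integral_Markov_inequality_measure[where A = "{}"])
       (use assms design_sum_moments(1)[OF assms(1)] in \<open>auto simp: design_sum_card\<close>)
  then show ?thesis
    by (simp add: design_sum_moments(2)[OF assms(1)])
qed

lemma cell_set_borel: "cell_set k j \<in> sets borel"
proof -
  have "{x \<in> space borel. cell k x = j} \<in> sets borel"
    by measurable
  then show ?thesis
    unfolding cell_set_def using sets.Int[OF lvl_measurable[of k]] by (simp add: Int_def)
qed

lemma cell_set_unif01: "cell_set k j \<in> sets unif01"
  using lvl_01 by (intro sets_unif01_borel cell_set_borel) (auto simp: cell_set_def)

lemma measure_cell_set_le: "measure unif01 (cell_set k j) \<le> 1 / 4 ^ (2 * k + 1)"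
proof -
  let ?m = "4 ^ (2 * k + 1) :: real"
  have sub: "cell_set k j \<subseteq> {real j / ?m .. (real j + 1) / ?m}"
  proof
    fix x assume x: "x \<in> cell_set k j"
    then have "0 \<le> x"
      using lvl_01[of x k] by (auto simp: cell_set_def)
    \<comment> \<open>Since \<open>x\<close> is nonnegative, \<open>nat\<close> does not truncate
      the floor.\<close>
    then have "int (nat \<lfloor>x * ?m\<rfloor>) = \<lfloor>x * ?m\<rfloor>"
      by simp
    moreover have "nat \<lfloor>x * ?m\<rfloor> = j"
      using x unfolding cell_set_def cell_def by blast
    ultimately have "int j = \<lfloor>x * ?m\<rfloor>"
      by metis
    then have "real j \<le> x * ?m" "x * ?m < real j + 1"
      by linarith+
    then show "x \<in> {real j / ?m .. (real j + 1) / ?m}"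
      by (simp add: field_simps del: power_Suc power_add)
  qed
  have "measure unif01 (cell_set k j) = measure lborel (cell_set k j)"
    unfolding measure_def using cell_set_borel lvl_01
    by (subst emeasure_unif01) (auto simp: cell_set_def)
  also have "\<dots> \<le> measure lborel {real j / ?m .. (real j + 1) / ?m}"
    using sub cell_set_borel
    by (intro measure_mono_fmeasurable fmeasurableI) (auto simp: emeasure_lborel_Icc_eq)
  also have "\<dots> = (real j + 1) / ?m - real j / ?m"
    by (intro measure_lborel_Icc divide_right_mono) auto
  also have "\<dots> = 1 / ?m"
    by (simp flip: diff_divide_distrib)
  finally show ?thesis .
qed

text \<open>In the expectation of a squared count minus the count the linear terms cancel, leaving
  \<open>n * (n - 1)\<close> times the squared cell measure. Summing over the cells and applying
  Markov's inequality gives the bound.\<close>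

lemma prob_collisions_large:
  fixes n :: nat
  assumes "0 < a"
  shows "measure (sample n) {d \<in> space (sample n). a \<le> collisions n d k} \<le> (real n)\<^sup>2 / (4 * 64 ^ k) / a"
proof -
  let ?p = "\<lambda>j. measure unif01 (cell_set k j)"
  note mom = design_sum_moments[OF cell_set_unif01]
  have int: "integrable (sample n) (\<lambda>d. collisions n d k)"
    unfolding collisions_def by (intro Bochner_Integration.integrable_sum Bochner_Integration.integrable_diff mom)
  have "(\<integral>d. collisions n d k \<partial>sample n) = (\<Sum>j<4 ^ (k + 1). n * (n - 1) * (?p j)\<^sup>2)"
    unfolding collisions_def
    by (subst Bochner_Integration.integral_sum) (simp_all add: mom)
  also have "\<dots> \<le> (\<Sum>j<(4::nat) ^ (k + 1). (real n)\<^sup>2 * (1 / 4 ^ (2 * k + 1))\<^sup>2)"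
  proof (intro sum_mono mult_mono power_mono measure_cell_set_le)
    have "n * (n - 1) \<le> n\<^sup>2"
      by (simp add: power2_eq_square)
    then show "real (n * (n - 1)) \<le> (real n)\<^sup>2"
      by (metis of_nat_le_iff of_nat_power)
  qed auto
  also have "\<dots> = (real n)\<^sup>2 * (4 ^ (k + 1) * (1 / 4 ^ (2 * k + 1))\<^sup>2)"
    by simp
  also have "4 ^ (k + 1) * (1 / 4 ^ (2 * k + 1))\<^sup>2 = 1 / (4 * 64 ^ k :: real)"
  proof -
    have "(64::real) ^ k = 4 ^ k * 4 ^ k * 4 ^ k" "(16::real) ^ k = 4 ^ k * 4 ^ k"
      by (simp_all flip: power_mult_distrib)
    then show ?thesis
      by (simp add: power_mult power2_eq_square field_simps)
  qed
  finally have E: "(\<integral>d. collisions n d k \<partial>sample n) \<le> (real n)\<^sup>2 / (4 * 64 ^ k)"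
    by simp
  have "measure (sample n) {d \<in> space (sample n). a \<le> collisions n d k}
      \<le> (\<integral>d. collisions n d k \<partial>sample n) / a"
    by (rule integral_Markov_inequality_measure[where A = "{}"]) (use int assms collisions_nonneg in auto)
  also have "\<dots> \<le> (real n)\<^sup>2 / (4 * 64 ^ k) / a"
    using E assms by (intro divide_right_mono) auto
  finally show ?thesis .
qed

text \<open>Chebyshev's inequality with the variance of the level. Its decay in \<open>k\<close>
  permits a union bound over infinitely many levels.\<close>

lemma prob_noise_sum_large:
  fixes n :: nat
  assumes "0 < a"
  shows "measure (sample n) {d \<in> space (sample n). a \<le> \<bar>noise_sum n d (lvl k)\<bar>}
    \<le> n * (192 / (real (k + 1))\<^sup>2) / a\<^sup>2"
proof -
  let ?f = "\<lambda>z. snd z * indicator (lvl k) (fst z) :: real"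
  interpret unif01: prob_space unif01 by (rule prob_space_unif01)
  interpret D: prob_space noise_law by (rule prob_space_noise_law)
  have ind: "(\<lambda>x. (4 / zeta k)\<^sup>2 * indicator (lvl k) x) \<in> borel_measurable unif01"
    by measurable
  have ae: "AE z in noise_law. (?f z)\<^sup>2 = (4 / zeta k)\<^sup>2 * indicator (lvl k) (fst z)"
    using AE_noise_law_abs
  proof eventually_elim
    case (elim z)
    show ?case
    proof (cases "fst z \<in> lvl k")
      case True
      then show ?thesis
        using elim noise_scale_lvl[OF True] by (simp flip: power2_abs[of "snd z"])
    qed simp
  qed
  have f: "?f \<in> borel_measurable noise_law"
    by measurable
  then have f2: "(\<lambda>z. (?f z)\<^sup>2) \<in> borel_measurable noise_law"
    by measurable
  have ind': "(\<lambda>z. (4 / zeta k)\<^sup>2 * indicator (lvl k) (fst z)) \<in> borel_measurable noise_law"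
    by measurable
  have int: "integrable noise_law (\<lambda>z. (?f z)\<^sup>2)"
    unfolding integrable_cong_AE[OF f2 ind' ae] integral_noise_law_fst(2)[OF ind]
    by (intro integrable_mult_right) (simp add: unif01.emeasure_eq_measure)
  have "(\<integral>z. (?f z)\<^sup>2 \<partial>noise_law) = (4 / zeta k)\<^sup>2 * measure unif01 (lvl k \<inter> {0..1})"
    unfolding integral_cong_AE[OF f2 ind' ae] integral_noise_law_fst(1)[OF ind] by simp
  also have "lvl k \<inter> {0..1} = lvl k"
    using lvl_01 by blast
  finally have V: "(\<integral>z. (?f z)\<^sup>2 \<partial>noise_law) = 192 / (real (k + 1))\<^sup>2"
    by (simp only: noise_variance_lvl)
  have mean: "integral\<^sup>L noise_law ?f = 0"
    by (rule integral_noise_weighted(2)) (auto simp: indicator_def)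
  show ?thesis
    using iid_chebyshev[OF prob_space_noise_law f int assms, of n]
    unfolding V mean by (simp add: noise_sum_def)
qed

section \<open>The union bound over the failure events\<close>

lemma measurable_sums:
  shows "A \<in> sets unif01 \<Longrightarrow> (\<lambda>d. design_sum n d A) \<in> borel_measurable (sample n)"
    "(\<lambda>d. noise_sum n d (lvl k)) \<in> borel_measurable (sample n)"
    "(\<lambda>d. collisions n d k) \<in> borel_measurable (sample n)"
proof -
  show design: "(\<lambda>d. design_sum n d A) \<in> borel_measurable (sample n)" if [measurable]: "A \<in> sets unif01" for A
    unfolding design_sum_def by measurable
  show "(\<lambda>d. noise_sum n d (lvl k)) \<in> borel_measurable (sample n)"
    unfolding noise_sum_def by measurable
  show "(\<lambda>d. collisions n d k) \<in> borel_measurable (sample n)"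
    unfolding collisions_def using design[OF cell_set_unif01]
    by (intro borel_measurable_sum borel_measurable_diff borel_measurable_power)
qed

text \<open>The four summands bound the failures of the hypotheses of
  \<open>norm2_minimizer_ge\<close>: too few points on level \<open>k\<close>, too many collisions,
  too many points on very fine levels, large noise on some level from \<open>k\<close> on. The unit
  of measurement \<open>y = n / 4 ^ k\<close> is of the order of the expected number of points on
  level \<open>k\<close>.\<close>

lemma prob_estimator_ge:
  fixes n k :: nat
  assumes est: "least_squares_estimator bumps (\<lambda>_. 0) noise_law fhat"
    and k: "64 * n \<le> 16 ^ k" "16 ^ k < 1024 * n"
  shows "1 - (12 / (real n / 4 ^ k) + 1 / 32 + 1 / 16 + 1024 * 49152 * (\<Sum>j. 1 / (real (j + k + 1))\<^sup>2))
    \<le> measure (sample n) {d \<in> space (sample n). sqrt 3 / (32 * 2 ^ k) \<le> norm2 unif01 (fhat n d)}"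
proof -
  interpret prob_space "sample n" by (rule prob_space_sample)
  define y where "y = real n / 4 ^ k"
  have n: "0 < n"
    using k(2) by (cases n) auto
  then have y: "0 < y"
    by (simp add: y_def)
  have sq: "(16::real) ^ k = 4 ^ k * 4 ^ k"
    by (simp flip: power_mult_distrib)
  have k': "64 * real n \<le> 16 ^ k" "16 ^ k < 1024 * real n"
    using k by (metis of_nat_le_iff of_nat_mult of_nat_numeral of_nat_power,
        metis of_nat_less_iff of_nat_mult of_nat_numeral of_nat_power)
  let ?fine = "{0..<1 / 4 ^ (k + 4)} :: real set"
  have fine: "?fine \<in> sets unif01"
  proof (rule sets_unif01_borel)
    have le: "1 / (4::real) ^ (k + 4) \<le> 1"
      by simp
    show "?fine \<subseteq> {0..1}"
    proof
      fix x :: real assume "x \<in> ?fine"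
      then have "0 \<le> x" "x < 1 / 4 ^ (k + 4)"
        by auto
      with le have "0 \<le> x \<and> x \<le> 1"
        by linarith
      then show "x \<in> {0..1}"
        by simp
    qed
  qed simp
  define E where "E = {d \<in> space (sample n). sqrt 3 / (32 * 2 ^ k) \<le> norm2 unif01 (fhat n d)}"
  define B1 where "B1 = {d \<in> space (sample n). y / 4 \<le> \<bar>design_sum n d (lvl k) - n * measure unif01 (lvl k)\<bar>}"
  define B2 where "B2 = {d \<in> space (sample n). y / 8 \<le> collisions n d k}"
  define B3 where "B3 = {d \<in> space (sample n). y / 16 \<le> design_sum n d ?fine}"
  define B4 where "B4 j = {d \<in> space (sample n). y / 16 \<le> \<bar>noise_sum n d (lvl (j + k))\<bar>}" for j
  have "(\<lambda>d. norm2 unif01 (fhat n d)) \<in> borel_measurable (sample n)"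
    using est unfolding least_squares_estimator_def sample_law_noise_law by simp
  then have E [measurable]: "E \<in> events"
    unfolding E_def by measurable
  have B [measurable]: "B1 \<in> events" "B2 \<in> events" "B3 \<in> events" "B4 j \<in> events" for j
    unfolding B1_def B2_def B3_def B4_def using measurable_sums(1)[OF lvl_sets_unif01]
      measurable_sums(1)[OF fine] measurable_sums(2,3) by measurable
  have mean: "n * measure unif01 (lvl k) = 3 / 4 * y"
    by (simp add: measure_lvl y_def)
  have p1: "prob B1 \<le> 12 / y"
  proof -
    have "prob B1 \<le> n * measure unif01 (lvl k) / (y / 4)\<^sup>2"
      unfolding B1_def using y by (intro prob_design_deviation) auto
    \<comment> \<open>The mean is \<open>3 / 4 * y\<close> and the allowed deviation is
      \<open>y / 4\<close>.\<close>
    also have "\<dots> = 12 / y"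
      using y by (simp add: mean power2_eq_square)
    finally show ?thesis .
  qed
  have p2: "prob B2 \<le> 1 / 32"
  proof -
    have "prob B2 \<le> (real n)\<^sup>2 / (4 * 64 ^ k) / (y / 8)"
      unfolding B2_def using y by (intro prob_collisions_large) auto
    also have "(64::real) ^ k = 4 ^ k * 16 ^ k"
      by (simp flip: power_mult_distrib)
    also have "(real n)\<^sup>2 / (4 * (4 ^ k * 16 ^ k)) / (y / 8) = 2 * (real n / 16 ^ k)"
      using n by (simp add: y_def power2_eq_square field_simps)
    \<comment> \<open>This is where the level must be fine enough:
      \<open>64 * n \<le> 16 ^ k\<close>.\<close>
    also have "\<dots> \<le> 1 / 32"
      using k'(1) by (simp add: field_simps)
    finally show ?thesis .
  qed
  have p3: "prob B3 \<le> 1 / 16"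
  proof -
    have "prob B3 \<le> n * measure unif01 ?fine / (y / 16)"
      unfolding B3_def using y by (intro prob_design_large fine) auto
    also have "measure unif01 ?fine = measure lborel ?fine"
      unfolding measure_def using fine sets.sets_into_space[OF fine] by (subst emeasure_unif01) auto
    also have "\<dots> = 1 / 4 ^ (k + 4)"
      by (subst measure_lborel_Ico) auto
    \<comment> \<open>The expected number of such points is \<open>y / 256\<close>, because the
      interval starts four levels further down.\<close>
    also have "n * (1 / 4 ^ (k + 4)) / (y / 16) = 1 / 16"
      using n by (simp add: y_def power_add)
    finally show ?thesis by simp
  qed
  define c where "c j = 1024 * 49152 * (1 / (real (j + k + 1))\<^sup>2)" for j
  have p4: "prob (B4 j) \<le> c j" for j
  proof -
    have "prob (B4 j) \<le> n * (192 / (real (j + k + 1))\<^sup>2) / (y / 16)\<^sup>2"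
      unfolding B4_def using y by (intro prob_noise_sum_large) auto
    \<comment> \<open>Here 49152 is 192 times 256. The quotient \<open>16 ^ k / n\<close> is below
      1024, which is where the level must not be too fine.\<close>
    also have "\<dots> = 16 ^ k / n * (49152 * (1 / (real (j + k + 1))\<^sup>2))"
    proof -
      have "n * (192 / D) / (y / 16)\<^sup>2 = 16 ^ k / n * (49152 * (1 / D))" for D :: real
        using n by (cases "D = 0") (auto simp: y_def power2_eq_square field_simps sq)
      then show ?thesis .
    qed
    also have "\<dots> \<le> 1024 * (49152 * (1 / (real (j + k + 1))\<^sup>2))"
      using k'(2) n by (intro mult_right_mono) (auto simp: field_simps)
    finally show ?thesis
      by (simp add: c_def)
  qed
  have sum: "summable (\<lambda>j. 1 / (real (j + k + 1))\<^sup>2)"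
  proof -
    have "summable (\<lambda>j. 1 / (real (j + 1))\<^sup>2)"
      using inverse_squares_sums by (simp add: sums_iff add.commute)
    from summable_ignore_initial_segment[OF this, of k] show ?thesis .
  qed
  then have c: "summable c" "suminf c = 1024 * 49152 * (\<Sum>j. 1 / (real (j + k + 1))\<^sup>2)"
    unfolding c_def[abs_def] by (rule summable_mult, rule suminf_mult)
  have p4': "prob (\<Union>j. B4 j) \<le> suminf c"
  proof -
    have s: "summable (\<lambda>j. prob (B4 j))"
      by (rule summable_comparison_test_ev[OF _ c(1)]) (use p4 in auto)
    have "prob (\<Union>j. B4 j) \<le> (\<Sum>j. prob (B4 j))"
      by (intro finite_measure_subadditive_countably s) auto
    also have "\<dots> \<le> suminf c"
      by (intro suminf_le p4 s c)
    finally show ?thesis .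
  qed
  have "AE d in sample n. \<forall>i\<in>{..<n}. \<bar>snd (d i)\<bar> = noise_scale (fst (d i))"
    by (intro AE_finite_allI AE_PiM_component prob_space_noise_law AE_noise_law_abs) auto
  then have "AE d in sample n. d \<in> E \<union> (B1 \<union> B2 \<union> B3 \<union> (\<Union>j. B4 j))"
    using AE_space
  proof eventually_elim
    case (elim d)
    show ?case
    proof (rule ccontr)
      assume notin: "\<not> ?case"
      have "sqrt 3 / (32 * 2 ^ k) \<le> norm2 unif01 (fhat n d)"
      proof (rule norm2_minimizer_ge[OF _ y])
        show "\<bar>snd (d i)\<bar> = noise_scale (fst (d i))" if "i < n" for i
          using elim(1) that by auto
        have "\<bar>design_sum n d (lvl k) - 3 / 4 * y\<bar> < y / 4"
          using notin elim(2) by (auto simp: B1_def mean)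
        then show "y / 2 < design_sum n d (lvl k)"
          by linarith
        show "collisions n d k < y / 8" "design_sum n d ?fine < y / 16"
          using notin elim(2) by (auto simp: B2_def B3_def)
        show "\<bar>noise_sum n d (lvl j)\<bar> < y / 16" if "k \<le> j" for j
        proof -
          have "d \<notin> B4 (j - k)"
            using notin by blast
          then show ?thesis
            using elim(2) that by (auto simp: B4_def)
        qed
        show "is_arg_min (squared_loss n d) (\<lambda>f. f \<in> bumps) (fhat n d)"
          using est elim(2) unfolding least_squares_estimator_def sample_law_noise_law by blast
      qed
      then show False
        using notin elim(2) by (auto simp: E_def)
    qed
  qed
  moreover have "E \<union> (B1 \<union> B2 \<union> B3 \<union> (\<Union>j. B4 j)) \<in> events"
    by measurable
  ultimately have "1 = prob (E \<union> (B1 \<union> B2 \<union> B3 \<union> (\<Union>j. B4 j)))"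
    using prob_eq_1 by metis
  also have "\<dots> \<le> prob E + prob (B1 \<union> B2 \<union> B3 \<union> (\<Union>j. B4 j))"
    by (rule measure_Un_le) auto
  also have "prob (B1 \<union> B2 \<union> B3 \<union> (\<Union>j. B4 j)) \<le> prob (B1 \<union> B2 \<union> B3) + prob (\<Union>j. B4 j)"
    by (rule measure_Un_le) auto
  also have "prob (B1 \<union> B2 \<union> B3) \<le> prob (B1 \<union> B2) + prob B3"
    by (rule measure_Un_le) auto
  also have "prob (B1 \<union> B2) \<le> prob B1 + prob B2"
    by (rule measure_Un_le) auto
  finally show ?thesis
    using p1 p2 p3 p4' unfolding c(2) E_def y_def by linarith
qed

section \<open>The level for a given sample size and the resulting rate\<close>

definition target_lvl :: "nat \<Rightarrow> nat" where
  "target_lvl n = (LEAST k. 64 * n \<le> 16 ^ k)"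

text \<open>Minimality costs one step of the power of 16, and 16 times 64 is 1024.\<close>

lemma target_lvl:
  assumes "0 < n"
  shows "64 * n \<le> 16 ^ target_lvl n" "16 ^ target_lvl n < 1024 * n"
proof -
  have "64 * n \<le> 16 ^ (64 * n)"
    by (rule less_imp_le[OF less_exp[THEN order.strict_trans2]]) (simp add: power_mono)
  then show le: "64 * n \<le> 16 ^ target_lvl n"
    unfolding target_lvl_def by (rule LeastI)
  show "16 ^ target_lvl n < 1024 * n"
  proof (cases "target_lvl n")
    case 0
    then show ?thesis
      using assms by simp
  next
    case (Suc j)
    then have "\<not> 64 * n \<le> 16 ^ j"
      using not_less_Least[of j "\<lambda>k. 64 * n \<le> 16 ^ k"] by (simp add: target_lvl_def)
    then show ?thesis
      using Suc by simp
  qed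
qed

lemma filterlim_target_lvl: "filterlim target_lvl at_top sequentially"
  unfolding filterlim_at_top
proof
  fix K
  have "K \<le> target_lvl n" if "16 ^ K \<le> n" for n
  proof -
    have "0 < n"
      using that by (metis gr0I not_le zero_less_numeral zero_less_power)
    then have "(16::nat) ^ K \<le> 16 ^ target_lvl n"
      using that target_lvl(1)[of n] by linarith
    then show ?thesis
      by (simp add: power_increasing_iff)
  qed
  then show "\<forall>\<^sub>F n in sequentially. K \<le> target_lvl n"
    by (auto simp: eventually_sequentially)
qed

text \<open>This tail is the price of the union bound over the noise sums; it vanishes because the
  target level grows with \<open>n\<close>.\<close>

lemma tail_tendsto_0: "(\<lambda>k. \<Sum>j. 1 / (real (j + k + 1))\<^sup>2) \<longlonglongrightarrow> 0"
proof -
  let ?f = "\<lambda>j. 1 / (real (j + 1))\<^sup>2"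
  have sum: "summable ?f"
    using inverse_squares_sums by (simp add: sums_iff add.commute)
  have "(\<lambda>k. suminf ?f - sum ?f {..<k}) \<longlonglongrightarrow> suminf ?f - suminf ?f"
    by (intro tendsto_intros summable_LIMSEQ sum)
  moreover have "(\<Sum>j. 1 / (real (j + k + 1))\<^sup>2) = suminf ?f - sum ?f {..<k}" for k
    using suminf_minus_initial_segment[OF sum, of k] by simp
  ultimately show ?thesis
    by simp
qed

lemma eventually_prob_estimator:
  assumes est: "least_squares_estimator bumps (\<lambda>_. 0) noise_law fhat"
  shows "\<forall>\<^sub>F n in sequentially.
    1 / 10 \<le> measure (sample n) {d \<in> space (sample n). real n powr (- 1 / 4) / 200 \<le> norm2 unif01 (fhat n d)}"
proof -
  have "(\<lambda>n. 1024 * 49152 * (\<Sum>j. 1 / (real (j + target_lvl n + 1))\<^sup>2)) \<longlonglongrightarrow> 1024 * 49152 * 0"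
    by (intro tendsto_intros filterlim_compose[OF tail_tendsto_0 filterlim_target_lvl])
  then have "\<forall>\<^sub>F n in sequentially. 1024 * 49152 * (\<Sum>j. 1 / (real (j + target_lvl n + 1))\<^sup>2) < 1 / 16"
    by (rule order_tendstoD) simp
  \<comment> \<open>Together with \<open>4 ^ k \<le> 32 * sqrt n\<close> this ensures
    \<open>n / 4 ^ k \<ge> 200\<close>.\<close>
  moreover have "\<forall>\<^sub>F n in sequentially. (200 * 32)\<^sup>2 \<le> n"
    by (rule eventually_ge_at_top)
  ultimately show ?thesis
  proof eventually_elim
    case (elim n)
    interpret prob_space "sample n" by (rule prob_space_sample)
    let ?k = "target_lvl n"
    have n: "0 < n"
      using elim(2) by simp
    note k = target_lvl[OF n]
    have k': "16 ^ ?k < 1024 * real n"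
      using k(2) by (metis of_nat_less_iff of_nat_mult of_nat_numeral of_nat_power)
    have four: "4 ^ ?k \<le> 32 * sqrt n"
    proof -
      have "sqrt (16 ^ ?k) \<le> sqrt (1024 * n)"
        using k' by simp
      moreover have "sqrt (16 ^ ?k) = 4 ^ ?k" "sqrt (1024 * n) = 32 * sqrt n"
        by (simp_all add: real_sqrt_power real_sqrt_mult)
      ultimately show ?thesis
        by simp
    qed
    have "200 \<le> real n / 4 ^ ?k"
    proof -
      have "200 * 32 \<le> sqrt n"
      proof (rule real_le_rsqrt)
        have "real ((200 * 32)\<^sup>2) \<le> real n"
          using elim(2) by (rule of_nat_mono)
        then show "(200 * 32)\<^sup>2 \<le> real n"
          by simp
      qed
      then have "200 * 32 * sqrt n \<le> sqrt n * sqrt n"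
        by (intro mult_right_mono) auto
      then have "200 * (32 * sqrt n) \<le> n"
        by simp
      with four show ?thesis
        by (simp add: field_simps)
    qed
    then have "12 / (real n / 4 ^ ?k) \<le> 12 / 200"
      using n by (intro divide_left_mono) auto
    \<comment> \<open>The failure probabilities 12/200, 1/32, 1/16 and 1/16 sum to less than
      1/4.\<close>
    then have "1 / 10 \<le> prob {d \<in> space (sample n). sqrt 3 / (32 * 2 ^ ?k) \<le> norm2 unif01 (fhat n d)}"
      using prob_estimator_ge[OF est k] elim(1) by linarith
    also have "\<dots> \<le> prob {d \<in> space (sample n). real n powr (- 1 / 4) / 200 \<le> norm2 unif01 (fhat n d)}"
    proof (rule finite_measure_mono)
      have "(\<lambda>d. norm2 unif01 (fhat n d)) \<in> borel_measurable (sample n)"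
        using est unfolding least_squares_estimator_def sample_law_noise_law by simp
      then show "{d \<in> space (sample n). real n powr (- 1 / 4) / 200 \<le> norm2 unif01 (fhat n d)} \<in> events"
        by measurable
      have "2 ^ ?k \<le> 6 * real n powr (1 / 4)"
      proof (rule power2_le_imp_le)
        have "(2 ^ ?k)\<^sup>2 = (4::real) ^ ?k"
          by (simp add: power2_eq_square flip: power_mult_distrib)
        also have "\<dots> \<le> 36 * sqrt n"
          using four by (rule order_trans) simp
        also have "\<dots> = (6 * real n powr (1 / 4))\<^sup>2"
          using n by (simp add: power_mult_distrib power2_eq_square powr_half_sqrt flip: powr_add)
        finally show "(2 ^ ?k)\<^sup>2 \<le> (6 * real n powr (1 / 4))\<^sup>2" .
      qed simp
      moreover have "1.2 \<le> sqrt 3"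
        by (intro real_le_rsqrt) (simp add: power2_eq_square)
      ultimately have "2 ^ ?k * 1 \<le> (6 * real n powr (1 / 4)) * (sqrt 3 / 1.2)"
        by (intro mult_mono) auto
      then have "2 ^ ?k \<le> 5 * (sqrt 3 * real n powr (1 / 4))"
        by (simp add: algebra_simps)
      moreover have "0 \<le> sqrt 3 * real n powr (1 / 4)"
        by simp
      ultimately have "4 * 2 ^ ?k \<le> 25 * (sqrt 3 * real n powr (1 / 4))"
        by linarith
      then have "real n powr (- 1 / 4) / 200 \<le> sqrt 3 / (32 * 2 ^ ?k)"
        using n by (simp add: powr_minus field_simps)
      then show "{d \<in> space (sample n). sqrt 3 / (32 * 2 ^ ?k) \<le> norm2 unif01 (fhat n d)}
          \<subseteq> {d \<in> space (sample n). real n powr (- 1 / 4) / 200 \<le> norm2 unif01 (fhat n d)}"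
        by auto
    qed
    finally show ?case .
  qed
qed

section \<open>One class and one error law for all exponents\<close>

theorem theorem5p2:
  fixes s :: real
  assumes "0 \<le> s" and "s \<le> 1"
  shows "\<exists>(F :: (real \<Rightarrow> real) set) (f0 :: real \<Rightarrow> real) (D :: (real \<times> real) measure).
    F \<subseteq> borel_measurable unif01 \<and> class_bound F < \<infinity> \<and>
    f0 \<in> F \<and>
    (\<exists>A \<alpha> \<beta>. A > 0 \<and> 0 \<le> \<alpha> \<and> \<alpha> \<le> 2 \<and> 0 \<le> \<beta> \<and>
       (\<forall>\<zeta>. 0 < \<zeta> \<and> \<zeta> < 1 \<longrightarrow>
          uniform_entropy \<zeta> (shifted_class F f0)
            \<le> ereal (A / \<zeta> powr \<alpha> * ln (1 / \<zeta>) powr \<beta>))) \<and>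
    (\<exists>C0 > 0. \<forall>\<delta> > 0.
       local_envelope F f0 \<delta> \<in> borel_measurable unif01 \<and>
       norm2 unif01 (local_envelope F f0 \<delta>)
         \<le> C0 * real_of_ereal (class_bound F) powr (1 - s) * \<delta> powr s) \<and>
    error_law D \<and>
    (\<exists>fhat. least_squares_estimator F f0 D fhat) \<and>
    (\<exists>C > 0. \<forall>fhat. least_squares_estimator F f0 D fhat \<longrightarrow>
       ereal (1 / 10) \<le> liminf (\<lambda>n. ereal (measure (sample_law f0 D n)
         {d \<in> space (sample_law f0 D n).
            C * real n powr (- 1 / (2 * (2 - s)))
              * ln (real n) powr (if s \<in> {0, 1} then 0 else - 2 / (s * (2 - s)))
            \<le> norm2 unif01 (\<lambda>x. fhat n d x - f0 x)})))"
proof -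
  let ?f0 = "\<lambda>_. 0 :: real" and ?\<Phi> = "real_of_ereal (class_bound bumps)"
  have measurable: "bumps \<subseteq> borel_measurable unif01"
    using bumps_measurable_borel borel_measurable_unif01I by blast
  have entropy: "\<exists>A \<alpha> \<beta>. A > 0 \<and> 0 \<le> \<alpha> \<and> \<alpha> \<le> 2 \<and> 0 \<le> \<beta> \<and>
       (\<forall>\<zeta>. 0 < \<zeta> \<and> \<zeta> < 1 \<longrightarrow>
          uniform_entropy \<zeta> (shifted_class bumps ?f0)
            \<le> ereal (A / \<zeta> powr \<alpha> * ln (1 / \<zeta>) powr \<beta>))"
    unfolding shifted_class_zero
  proof (intro exI conjI allI impI)
    \<comment> \<open>This bound fixes the witnesses: the constant 60 and both exponents equal to
      2.\<close>
    show "uniform_entropy \<zeta> bumps \<le> ereal (60 / \<zeta> powr 2 * ln (1 / \<zeta>) powr 2)"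
      if "0 < \<zeta> \<and> \<zeta> < 1" for \<zeta>
      using that uniform_entropy_bumps by blast
  qed simp_all
  have \<Phi>: "0 < ?\<Phi> powr (1 - s)"
    using class_bound_bumps(2) by simp
  have envelope: "\<exists>C0 > 0. \<forall>\<delta> > 0.
       local_envelope bumps ?f0 \<delta> \<in> borel_measurable unif01 \<and>
       norm2 unif01 (local_envelope bumps ?f0 \<delta>) \<le> C0 * ?\<Phi> powr (1 - s) * \<delta> powr s"
  \<comment> \<open>Dividing by the power of the class bound cancels the same factor in the
    claim.\<close>
  proof (intro exI[of _ "6 / ?\<Phi> powr (1 - s)"] conjI allI impI local_envelope_bumps_measurable)
    fix \<delta> :: real assume "0 < \<delta>"
    then show "norm2 unif01 (local_envelope bumps ?f0 \<delta>)
        \<le> 6 / ?\<Phi> powr (1 - s) * ?\<Phi> powr (1 - s) * \<delta> powr s"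
      using norm2_local_envelope_bumps[OF _ assms] \<Phi> by simp
  qed (use \<Phi> in simp)
  \<comment> \<open>The power of \<open>n\<close> is largest at \<open>s = 0\<close>, where it is
    the rate already obtained. From \<open>n = 3\<close> on the logarithm is at least 1, so its
    nonpositive power is at most 1.\<close>
  have rate_le: "1 / 200 * real n powr (- 1 / (2 * (2 - s)))
      * ln (real n) powr (if s \<in> {0, 1} then 0 else - 2 / (s * (2 - s)))
      \<le> real n powr (- 1 / 4) / 200" if "3 \<le> n" for n :: nat
  proof -
    have "exp 1 \<le> real n"
      using exp_le that by linarith
    then have "1 \<le> ln (real n)"
      using that by (subst ln_ge_iff) auto
    moreover have "0 \<le> s * (2 - s)"
      using assms by simp
    ultimately have "ln (real n) powr (if s \<in> {0, 1} then 0 else - 2 / (s * (2 - s))) \<le> ln (real n) powr 0"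
      by (intro powr_mono) auto
    then have "ln (real n) powr (if s \<in> {0, 1} then 0 else - 2 / (s * (2 - s))) \<le> 1"
      using \<open>1 \<le> ln (real n)\<close> by simp
    moreover have "real n powr (- 1 / (2 * (2 - s))) \<le> real n powr (- 1 / 4)"
      using assms that by (intro powr_mono) (auto simp: field_simps)
    ultimately have "real n powr (- 1 / (2 * (2 - s)))
        * ln (real n) powr (if s \<in> {0, 1} then 0 else - 2 / (s * (2 - s))) \<le> real n powr (- 1 / 4) * 1"
      by (intro mult_mono) auto
    then show ?thesis
      by simp
  qed
  have rate: "ereal (1 / 10) \<le> liminf (\<lambda>n. ereal (measure (sample_law ?f0 noise_law n)
         {d \<in> space (sample_law ?f0 noise_law n).
            1 / 200 * real n powr (- 1 / (2 * (2 - s)))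
              * ln (real n) powr (if s \<in> {0, 1} then 0 else - 2 / (s * (2 - s)))
            \<le> norm2 unif01 (\<lambda>x. fhat n d x - ?f0 x)}))"
    if est: "least_squares_estimator bumps ?f0 noise_law fhat" for fhat
    unfolding sample_law_noise_law
  proof (rule Liminf_bounded)
    show "\<forall>\<^sub>F n in sequentially. ereal (1 / 10) \<le> ereal (measure (sample n)
         {d \<in> space (sample n). 1 / 200 * real n powr (- 1 / (2 * (2 - s)))
              * ln (real n) powr (if s \<in> {0, 1} then 0 else - 2 / (s * (2 - s)))
            \<le> norm2 unif01 (\<lambda>x. fhat n d x - ?f0 x)})"
      using eventually_prob_estimator[OF est] eventually_ge_at_top[of 3]
    proof eventually_elim
      case (elim n)
      interpret prob_space "sample n" by (rule prob_space_sample)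
      define r where "r = 1 / 200 * real n powr (- 1 / (2 * (2 - s)))
              * ln (real n) powr (if s \<in> {0, 1} then 0 else - 2 / (s * (2 - s)))"
      have r: "r \<le> real n powr (- 1 / 4) / 200"
        unfolding r_def by (rule rate_le[OF elim(2)])
      have "(\<lambda>d. norm2 unif01 (fhat n d)) \<in> borel_measurable (sample n)"
        using est unfolding least_squares_estimator_def sample_law_noise_law by simp
      then have "{d \<in> space (sample n). r \<le> norm2 unif01 (fhat n d)} \<in> events"
        by measurable
      \<comment> \<open>Lowering the threshold enlarges the event.\<close>
      then have "prob {d \<in> space (sample n). real n powr (- 1 / 4) / 200 \<le> norm2 unif01 (fhat n d)}
          \<le> prob {d \<in> space (sample n). r \<le> norm2 unif01 (fhat n d)}"
        using r by (intro finite_measure_mono) auto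
      then show ?case
        using elim(1) by (simp add: r_def)
    qed
  qed
  have rate': "\<exists>C > 0. \<forall>fhat. least_squares_estimator bumps ?f0 noise_law fhat \<longrightarrow>
       ereal (1 / 10) \<le> liminf (\<lambda>n. ereal (measure (sample_law ?f0 noise_law n)
         {d \<in> space (sample_law ?f0 noise_law n).
            C * real n powr (- 1 / (2 * (2 - s)))
              * ln (real n) powr (if s \<in> {0, 1} then 0 else - 2 / (s * (2 - s)))
            \<le> norm2 unif01 (\<lambda>x. fhat n d x - ?f0 x)}))"
    by (rule exI[of _ "1 / 200"], intro conjI allI impI, simp, rule rate)
  show ?thesis
    by (intro exI[of _ bumps] exI[of _ ?f0] exI[of _ noise_law])
       (intro conjI measurable class_bound_bumps(1) zero_in_bumps entropy envelope error_law_noise_law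
         least_squares_estimator_exists rate')
qed

end
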